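(* Let $(X,\mu,\sigma)$ be a dynamical system such that $\sigma$ is the coding map of some branching function system $f=\{f_1,f_2\}$ on $(X,\mu)$. Put $A_1 := f_1(X)$ and assume that $$\mu\Bigl(X\setminus\bigcup_{n\ge 1}\sigma^{-n}(A_1)\Bigr)=0 .$$ Let $\pi_f$ be the representation of $\mathcal{O}_2=C^*\langle t_1,t_2\rangle$ on $L_2(X,\mu)$ associated with $f$, i.e. $\pi_f(t_i)=S(f_i)$ for $i=1,2$, and let $J_{\sigma,A_1}$ be the jump transformation of $(\sigma,A_1)$. Regard $\mathcal{O}_\infty=C^*\langle s_n : n\in\mathbf{N}\rangle$ as a subalgebra of $\mathcal{O}_2$ via the embedding $s_n=t_2^{\,n-1}t_1$ $(n\ge 1)$, where $t_2^0:=I$. Then the following hold. (i) There exists a branching function system $g=\{g_n : n\in\mathbf{N}\}$ on $(X,\mu)$ with the coding map $J_{\sigma,A_1}$ such that the representation $\pi_g$ of $\mathcal{O}_\infty$ on $L_2(X,\mu)$ given by $\pi_g(s_n)=S(g_n)$ $(n\in\mathbf{N})$ coincides with the restriction of $\pi_f$ to $\mathcal{O}_\infty$: $$\pi_f|_{\mathcal{O}_\infty}=\pi_g .$$ (ii) If $\phi$ is the density of an invariant measure with respect to $\sigma$, that is, $\nu(E):=\int_E\phi(x)\,d\mu(x)$ $(E\subset X$ measurable$)$ defines a $\sigma$-invariant measure $\nu$ on $X$, and $\phi$ belongs to $L_1(X,\mu)$, then the function $\psi$ on $X$ defined by $$\psi(x)=\Bigl\{\{\pi_f(t_1)^*\sqrt{\phi}\}(x)\Bigr\}^2\qquad(x\in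 X)$$ is the density (with respect to $\mu$) of an invariant measure of $J_{\sigma,A_1}$, where $\sqrt{\phi}(x):=\sqrt{\phi(x)}$.
   Context: **Dynamical systems and invariant measures.** A (measure theoretical) dynamical system $(X,\mu,T)$ consists of a measure space $(X,\mu)$ and a measurable map $T:X\to X$, not necessarily invertible. A measure $\nu$ on $X$ is $T$-invariant if $\nu(T^{-1}(E))=\nu(E)$ for every measurable $E\subset X$. For a measurable map $T$ write $(\mu\circ T)(E):=\mu(T(E))$. Writing a Radon–Nikodým derivative presupposes that it exists and is well defined up to $\mu$-almost everywhere equality (as for $\sigma$-finite measures). **Cuntz algebras.** $\mathbf{N}=\{1,2,3,\ldots\}$. For $2\le N\le\infty$, $\mathcal{O}_N$ is the Cuntz algebra: the universal unital $C^*$-algebra generated by $s_1,\ldots,s_N$ (by $s_1,s_2,\ldots$ if $N=\infty$) with $s_i^*s_j=\delta_{ij}I$, and $\sum_{i=1}^N s_is_i^*=I$ if $N<\infty$, respectively $\sum_{i=1}^k s_is_i^*\le I$ for all $k\ge1$ if $N=\infty$. The canonical generators of $\mathcal{O}_2$ are denoted $t_1,t_2$ and those of $\mathcal{O}_\infty$ are denoted $s_n$, $n\in\mathbf{N}$. If elements of a unital $C^*$-algebra satisfy the relations of the canonical generators of $\mathcal{O}_N$, the correspondence of generators extends uniquely to a unital $*$-embedding of $\mathcal{O}_N$. **Branching function systems.** Let $\Omega_N=\{1,\ldots,N\}$ for $N<\infty$ and $\Omega_\infty=\mathbf{N}$. A family $f=\{f_i:i\in\Omega_N\}$ of maps on $X$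 is a branching function system on $(X,\mu)$ if: (1) each $f_i:X\to X$ is measurable; (2) with $R_i:=f_i(X)$, $\mu(X\setminus\bigcup_{i\in\Omega_N}R_i)=0$ and $\mu(R_i\cap R_j)=0$ for $i\ne j$; (3) for each $i$ the Radon–Nikodým derivative $\Phi_{f_i}$ of $\mu\circ f_i$ with respect to $\mu$ exists and $\Phi_{f_i}>0$ almost everywhere in $X$. A map $F$ on $X$ is the coding map of $f$ if $F\circ f_i=\mathrm{id}_X$ for each $i\in\Omega_N$. **Associated representation.** For a branching function system $f=\{f_i:i\in\Omega_N\}$ with coding map $F$, define operators $S(f_i)$ on $L_2(X,\mu)$ (square integrable complex-valued functions) by $$\{S(f_i)\phi\}(x)=\chi_{R_i}(x)\,\{\Phi_F(x)\}^{1/2}\,\phi(F(x))\qquad(\phi\in L_2(X,\mu),\ x\in X),$$ where $\chi_{R_i}$ is the characteristic function of $R_i$ and, on $R_i$, $\Phi_F$ is the Radon–Nikodým derivative with respect to $\mu$ of $E\mapsto\mu(F(E))$ $(E\subset R_i)$. Their adjoints are $\{S(f_i)^*\phi\}(x)=\{\Phi_{f_i}(x)\}^{1/2}\phi(f_i(x))$. The operators $S(f_i)$ satisfy the relations of the canonical generators of $\mathcal{O}_N$, so $\pi_f(s_i):=S(f_i)$ $(i\in\Omega_N)$ defines a representation $(L_2(X,\mu),\pi_f)$ of $\mathcal{O}_N$. **Jump transformation.** Let $(X,\mu,T)$ be a dynamical system and $A\subset X$ a measurable subset with $\mu(X\setminus\bigcup_{n\ge1}T^{-n}(A))=0$. The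 first entry time of $(T,A)$ is $e(x):=\min\{k\in\mathbf{Z}_{\ge0}:T^k(x)\in A\}$ (finite for almost every $x$), and the jump transformation of $(T,A)$ is $J_{T,A}(x):=T^{e(x)+1}(x)$ (defined wherever $e(x)<\infty$, hence almost everywhere). *)

theory Defs
  imports "HOL-Analysis.Analysis" "HOL-Algebra.Ring" "HOL-Library.Extended_Nat"
begin

section \<open>Unital C*-algebras\<close>

record 'a cstar_algebra = "'a ring" +
  cscale :: "complex \<Rightarrow> 'a \<Rightarrow> 'a"
  cadj :: "'a \<Rightarrow> 'a"
  cnorm :: "'a \<Rightarrow> real"

locale unital_cstar_algebra = ring A for A :: "('a, 'm) cstar_algebra_scheme" (structure) +
  assumes one_not_zero: "\<one> \<noteq> \<zero>"
    and cscale_closed: "x \<in> carrier A \<Longrightarrow> cscale A a x \<in> carrier A"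
    and cscale_add_right: "\<lbrakk>x \<in> carrier A; y \<in> carrier A\<rbrakk> \<Longrightarrow>
          cscale A a (x \<oplus> y) = cscale A a x \<oplus> cscale A a y"
    and cscale_add_left: "x \<in> carrier A \<Longrightarrow> cscale A (a + b) x = cscale A a x \<oplus> cscale A b x"
    and cscale_cscale: "x \<in> carrier A \<Longrightarrow> cscale A a (cscale A b x) = cscale A (a * b) x"
    and cscale_one: "x \<in> carrier A \<Longrightarrow> cscale A 1 x = x"
    and cscale_mult_left: "\<lbrakk>x \<in> carrier A; y \<in> carrier A\<rbrakk> \<Longrightarrow>
          cscale A a x \<otimes> y = cscale A a (x \<otimes> y)"
    and cscale_mult_right: "\<lbrakk>x \<in> carrier A; y \<in> carrier A\<rbrakk> \<Longrightarrow>
          x \<otimes> cscale A a y = cscale A a (x \<otimes> y)"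
    and cadj_closed: "x \<in> carrier A \<Longrightarrow> cadj A x \<in> carrier A"
    and cadj_cadj: "x \<in> carrier A \<Longrightarrow> cadj A (cadj A x) = x"
    and cadj_add: "\<lbrakk>x \<in> carrier A; y \<in> carrier A\<rbrakk> \<Longrightarrow> cadj A (x \<oplus> y) = cadj A x \<oplus> cadj A y"
    and cadj_cscale: "x \<in> carrier A \<Longrightarrow> cadj A (cscale A a x) = cscale A (cnj a) (cadj A x)"
    and cadj_mult: "\<lbrakk>x \<in> carrier A; y \<in> carrier A\<rbrakk> \<Longrightarrow> cadj A (x \<otimes> y) = cadj A y \<otimes> cadj A x"
    and cnorm_nonneg: "x \<in> carrier A \<Longrightarrow> 0 \<le> cnorm A x"
    and cnorm_eq_zero: "x \<in> carrier A \<Longrightarrow> cnorm A x = 0 \<longleftrightarrow> x = \<zero>"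
    and cnorm_triangle: "\<lbrakk>x \<in> carrier A; y \<in> carrier A\<rbrakk> \<Longrightarrow> cnorm A (x \<oplus> y) \<le> cnorm A x + cnorm A y"
    and cnorm_cscale: "x \<in> carrier A \<Longrightarrow> cnorm A (cscale A a x) = cmod a * cnorm A x"
    and cnorm_mult: "\<lbrakk>x \<in> carrier A; y \<in> carrier A\<rbrakk> \<Longrightarrow> cnorm A (x \<otimes> y) \<le> cnorm A x * cnorm A y"
    and cstar_identity: "x \<in> carrier A \<Longrightarrow> cnorm A (cadj A x \<otimes> x) = (cnorm A x)\<^sup>2"
    and cnorm_complete: "\<lbrakk>\<And>n. u n \<in> carrier A;
          \<And>e. 0 < e \<Longrightarrow> \<exists>K. \<forall>m\<ge>K. \<forall>n\<ge>K. cnorm A (u m \<ominus> u n) < e\<rbrakk> \<Longrightarrow>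
          \<exists>l\<in>carrier A. (\<lambda>n. cnorm A (u n \<ominus> l)) \<longlonglongrightarrow> 0"

text \<open>The order of a C*-algebra; the positive elements are those of the form \<open>z* z\<close>.\<close>

definition cstar_le :: "('a, 'm) cstar_algebra_scheme \<Rightarrow> 'a \<Rightarrow> 'a \<Rightarrow> bool" where
  "cstar_le A x y \<longleftrightarrow> (\<exists>z\<in>carrier A. y \<ominus>\<^bsub>A\<^esub> x = cadj A z \<otimes>\<^bsub>A\<^esub> z)"

definition unital_star_hom ::
  "('a, 'm) cstar_algebra_scheme \<Rightarrow> ('b, 'n) cstar_algebra_scheme \<Rightarrow> ('a \<Rightarrow> 'b) \<Rightarrow> bool" where
  "unital_star_hom A B h \<longleftrightarrow>
     h \<in> carrier A \<rightarrow> carrier B \<and>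
     (\<forall>x\<in>carrier A. \<forall>y\<in>carrier A. h (x \<oplus>\<^bsub>A\<^esub> y) = h x \<oplus>\<^bsub>B\<^esub> h y) \<and>
     (\<forall>a. \<forall>x\<in>carrier A. h (cscale A a x) = cscale B a (h x)) \<and>
     (\<forall>x\<in>carrier A. \<forall>y\<in>carrier A. h (x \<otimes>\<^bsub>A\<^esub> y) = h x \<otimes>\<^bsub>B\<^esub> h y) \<and>
     (\<forall>x\<in>carrier A. h (cadj A x) = cadj B (h x)) \<and>
     h \<one>\<^bsub>A\<^esub> = \<one>\<^bsub>B\<^esub>"

definition unital_star_embedding ::
  "('a, 'm) cstar_algebra_scheme \<Rightarrow> ('b, 'n) cstar_algebra_scheme \<Rightarrow> ('a \<Rightarrow> 'b) \<Rightarrow> bool" where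
  "unital_star_embedding A B h \<longleftrightarrow> unital_star_hom A B h \<and> inj_on h (carrier A)"

definition closed_star_subalgebra :: "('a, 'm) cstar_algebra_scheme \<Rightarrow> 'a set \<Rightarrow> bool" where
  "closed_star_subalgebra A B \<longleftrightarrow>
     B \<subseteq> carrier A \<and> \<one>\<^bsub>A\<^esub> \<in> B \<and>
     (\<forall>x\<in>B. \<forall>y\<in>B. x \<oplus>\<^bsub>A\<^esub> y \<in> B) \<and>
     (\<forall>a. \<forall>x\<in>B. cscale A a x \<in> B) \<and>
     (\<forall>x\<in>B. \<forall>y\<in>B. x \<otimes>\<^bsub>A\<^esub> y \<in> B) \<and>
     (\<forall>x\<in>B. cadj A x \<in> B) \<and>
     (\<forall>u l. (\<forall>n. u n \<in> B) \<and> l \<in> carrier A \<and> (\<lambda>n::nat. cnorm A (u n \<ominus>\<^bsub>A\<^esub> l)) \<longlonglongrightarrow> 0 \<longrightarrow> l \<in> B)"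

definition generates_cstar :: "('a, 'm) cstar_algebra_scheme \<Rightarrow> 'a set \<Rightarrow> bool" where
  "generates_cstar A S \<longleftrightarrow> S \<subseteq> carrier A \<and>
     (\<forall>B. closed_star_subalgebra A B \<and> S \<subseteq> B \<longrightarrow> B = carrier A)"

section \<open>Cuntz algebras\<close>

definition \<Omega> :: "enat \<Rightarrow> nat set" where
  "\<Omega> N = {i. 1 \<le> i \<and> enat i \<le> N}"

definition cuntz_relations ::
  "enat \<Rightarrow> ('a, 'm) cstar_algebra_scheme \<Rightarrow> (nat \<Rightarrow> 'a) \<Rightarrow> bool" where
  "cuntz_relations N A s \<longleftrightarrow>
     (\<forall>i\<in>\<Omega> N. s i \<in> carrier A) \<and>
     (\<forall>i\<in>\<Omega> N. \<forall>j\<in>\<Omega> N. cadj A (s i) \<otimes>\<^bsub>A\<^esub> s j = (if i = j then \<one>\<^bsub>A\<^esub> else \<zero>\<^bsub>A\<^esub>)) \<and>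
     (case N of
        enat n \<Rightarrow> finsum A (\<lambda>i. s i \<otimes>\<^bsub>A\<^esub> cadj A (s i)) {1..n} = \<one>\<^bsub>A\<^esub>
      | \<infinity> \<Rightarrow> (\<forall>k\<ge>1. cstar_le A (finsum A (\<lambda>i. s i \<otimes>\<^bsub>A\<^esub> cadj A (s i)) {1..k}) \<one>\<^bsub>A\<^esub>))"

text \<open>
  \<open>A\<close> is the Cuntz algebra \<open>O_N\<close> with canonical generators \<open>s\<close>.  The test algebras \<open>B\<close> of the
  universal property live on the same type as \<open>A\<close>.  This is no restriction: a nonzero complex
  vector space has at least continuum many elements, and the C*-subalgebra generated by a
  countable family has at most that many, so every C*-algebra generated by a family satisfying
  the relations has an isomorphic copy on the type \<open>'a\<close>.  Uniqueness of \<open>h\<close> on the carrier follows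
  from generation.
\<close>

definition is_cuntz_algebra :: "enat \<Rightarrow> 'a cstar_algebra \<Rightarrow> (nat \<Rightarrow> 'a) \<Rightarrow> bool" where
  "is_cuntz_algebra N A s \<longleftrightarrow>
     unital_cstar_algebra A \<and> cuntz_relations N A s \<and> generates_cstar A (s ` \<Omega> N) \<and>
     (\<forall>(B :: 'a cstar_algebra) u. unital_cstar_algebra B \<and> cuntz_relations N B u \<longrightarrow>
        (\<exists>h. unital_star_hom A B h \<and> (\<forall>i\<in>\<Omega> N. h (s i) = u i)))"

section \<open>The Hilbert space of square integrable functions\<close>

text \<open>
  Elements of \<open>L_2\<close> are represented by functions, and equality in \<open>L_2\<close> by equality almost
  everywhere; accordingly an operator is a map on functions that respects it, and two operators
  are identified if their values agree almost everywhere.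
\<close>

definition L2 :: "'x measure \<Rightarrow> ('x \<Rightarrow> complex) set" where
  "L2 M = {\<phi> \<in> borel_measurable M. integrable M (\<lambda>x. (cmod (\<phi> x))\<^sup>2)}"

definition L2_inner :: "'x measure \<Rightarrow> ('x \<Rightarrow> complex) \<Rightarrow> ('x \<Rightarrow> complex) \<Rightarrow> complex" where
  "L2_inner M \<phi> \<psi> = (LINT x|M. \<phi> x * cnj (\<psi> x))"

definition L2_norm :: "'x measure \<Rightarrow> ('x \<Rightarrow> complex) \<Rightarrow> real" where
  "L2_norm M \<phi> = sqrt (LINT x|M. (cmod (\<phi> x))\<^sup>2)"

definition L2_bounded_operator ::
  "'x measure \<Rightarrow> (('x \<Rightarrow> complex) \<Rightarrow> ('x \<Rightarrow> complex)) \<Rightarrow> bool" where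
  "L2_bounded_operator M T \<longleftrightarrow>
     T \<in> L2 M \<rightarrow> L2 M \<and>
     (\<forall>\<phi>\<in>L2 M. \<forall>\<psi>\<in>L2 M. (AE x in M. \<phi> x = \<psi> x) \<longrightarrow> (AE x in M. T \<phi> x = T \<psi> x)) \<and>
     (\<forall>\<phi>\<in>L2 M. \<forall>\<psi>\<in>L2 M. AE x in M. T (\<lambda>y. \<phi> y + \<psi> y) x = T \<phi> x + T \<psi> x) \<and>
     (\<forall>a. \<forall>\<phi>\<in>L2 M. AE x in M. T (\<lambda>y. a * \<phi> y) x = a * T \<phi> x) \<and>
     (\<exists>C. \<forall>\<phi>\<in>L2 M. L2_norm M (T \<phi>) \<le> C * L2_norm M \<phi>)"

definition L2_operator_eq :: "'x measure \<Rightarrow> (('x \<Rightarrow> complex) \<Rightarrow> ('x \<Rightarrow> complex)) \<Rightarrow>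
    (('x \<Rightarrow> complex) \<Rightarrow> ('x \<Rightarrow> complex)) \<Rightarrow> bool" where
  "L2_operator_eq M S T \<longleftrightarrow> (\<forall>\<phi>\<in>L2 M. AE x in M. S \<phi> x = T \<phi> x)"

text \<open>The Hilbert space adjoint; its values are determined up to equality almost everywhere.\<close>

definition L2_adjoint :: "'x measure \<Rightarrow> (('x \<Rightarrow> complex) \<Rightarrow> ('x \<Rightarrow> complex)) \<Rightarrow>
    ('x \<Rightarrow> complex) \<Rightarrow> ('x \<Rightarrow> complex)" where
  "L2_adjoint M T \<phi> =
     (SOME h. h \<in> L2 M \<and> (\<forall>\<psi>\<in>L2 M. L2_inner M (T \<psi>) \<phi> = L2_inner M \<psi> h))"

definition L2_representation ::
  "('a, 'm) cstar_algebra_scheme \<Rightarrow> 'x measure \<Rightarrow>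
     ('a \<Rightarrow> ('x \<Rightarrow> complex) \<Rightarrow> ('x \<Rightarrow> complex)) \<Rightarrow> bool" where
  "L2_representation A M \<pi> \<longleftrightarrow>
     (\<forall>a\<in>carrier A. L2_bounded_operator M (\<pi> a)) \<and>
     (\<forall>a\<in>carrier A. \<forall>b\<in>carrier A.
        L2_operator_eq M (\<pi> (a \<oplus>\<^bsub>A\<^esub> b)) (\<lambda>\<phi> x. \<pi> a \<phi> x + \<pi> b \<phi> x)) \<and>
     (\<forall>c. \<forall>a\<in>carrier A. L2_operator_eq M (\<pi> (cscale A c a)) (\<lambda>\<phi> x. c * \<pi> a \<phi> x)) \<and>
     (\<forall>a\<in>carrier A. \<forall>b\<in>carrier A. L2_operator_eq M (\<pi> (a \<otimes>\<^bsub>A\<^esub> b)) (\<pi> a \<circ> \<pi> b)) \<and>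
     (\<forall>a\<in>carrier A. \<forall>\<phi>\<in>L2 M. \<forall>\<psi>\<in>L2 M.
        L2_inner M (\<pi> a \<phi>) \<psi> = L2_inner M \<phi> (\<pi> (cadj A a) \<psi>)) \<and>
     L2_operator_eq M (\<pi> \<one>\<^bsub>A\<^esub>) id"

section \<open>Branching function systems\<close>

text \<open>For \<open>K\<close> a measure on (a measurable subset of) the space of \<open>M\<close>: the measure \<open>M \<circ> T\<close> on \<open>K\<close>.\<close>

definition comp_measure :: "'x measure \<Rightarrow> 'x measure \<Rightarrow> ('x \<Rightarrow> 'x) \<Rightarrow> 'x measure" where
  "comp_measure K M T = measure_of (space K) (sets K) (\<lambda>E. emeasure M (T ` E))"

text \<open>
  The guards rule out the default values of \<^const>\<open>emeasure\<close> and \<^const>\<open>measure_of\<close> for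
  images that are not measurable, and set functions that are not measures.
\<close>

definition comp_measure_ok :: "'x measure \<Rightarrow> 'x measure \<Rightarrow> ('x \<Rightarrow> 'x) \<Rightarrow> bool" where
  "comp_measure_ok K M T \<longleftrightarrow>
     (\<forall>E\<in>sets K. T ` E \<in> sets M) \<and> measure_space (space K) (sets K) (\<lambda>E. emeasure M (T ` E))"

text \<open>
  No sigma-finiteness is assumed; instead, the existence of a Radon-Nikodym derivative includes
  that it is well defined up to equality almost everywhere.
\<close>

definition has_RN_deriv :: "'x measure \<Rightarrow> 'x measure \<Rightarrow> bool" where
  "has_RN_deriv M N \<longleftrightarrow>
     (\<exists>\<Phi>\<in>borel_measurable M. density M \<Phi> = N \<and>
        (\<forall>\<Psi>\<in>borel_measurable M. density M \<Psi> = N \<longrightarrow> (AE x in M. \<Psi> x = \<Phi> x)))"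

definition branching_function_system ::
  "'x measure \<Rightarrow> enat \<Rightarrow> (nat \<Rightarrow> 'x \<Rightarrow> 'x) \<Rightarrow> bool" where
  "branching_function_system M N f \<longleftrightarrow>
     (\<forall>i\<in>\<Omega> N. f i \<in> measurable M M) \<and>
     emeasure M (space M - (\<Union>i\<in>\<Omega> N. f i ` space M)) = 0 \<and>
     (\<forall>i\<in>\<Omega> N. \<forall>j\<in>\<Omega> N. i \<noteq> j \<longrightarrow> emeasure M (f i ` space M \<inter> f j ` space M) = 0) \<and>
     (\<forall>i\<in>\<Omega> N. comp_measure_ok M M (f i) \<and> has_RN_deriv M (comp_measure M M (f i)) \<and>
        (AE x in M. 0 < RN_deriv M (comp_measure M M (f i)) x))"

definition coding_map ::
  "'x measure \<Rightarrow> enat \<Rightarrow> (nat \<Rightarrow> 'x \<Rightarrow> 'x) \<Rightarrow> ('x \<Rightarrow> 'x) \<Rightarrow> bool" where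
  "coding_map M N f F \<longleftrightarrow>
     F \<in> space M \<rightarrow> space M \<and> (\<forall>i\<in>\<Omega> N. \<forall>x\<in>space M. F (f i x) = x)"

text \<open>The operator \<open>S(f\<^sub>i)\<close>, for \<open>h = f\<^sub>i\<close> and the coding map \<open>F\<close>.\<close>

definition branch_operator ::
  "'x measure \<Rightarrow> ('x \<Rightarrow> 'x) \<Rightarrow> ('x \<Rightarrow> 'x) \<Rightarrow> ('x \<Rightarrow> complex) \<Rightarrow> ('x \<Rightarrow> complex)" where
  "branch_operator M F h \<phi> = (\<lambda>x.
     let K = restrict_space M (h ` space M) in
     indicator (h ` space M) x *
       complex_of_real (sqrt (enn2real (RN_deriv K (comp_measure K M F) x))) * \<phi> (F x))"

definition associated_representation ::
  "'x measure \<Rightarrow> enat \<Rightarrow> (nat \<Rightarrow> 'x \<Rightarrow> 'x) \<Rightarrow> ('x \<Rightarrow> 'x) \<Rightarrow>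
     ('a, 'm) cstar_algebra_scheme \<Rightarrow> (nat \<Rightarrow> 'a) \<Rightarrow>
     ('a \<Rightarrow> ('x \<Rightarrow> complex) \<Rightarrow> ('x \<Rightarrow> complex)) \<Rightarrow> bool" where
  "associated_representation M N f F A s \<pi> \<longleftrightarrow>
     L2_representation A M \<pi> \<and>
     (\<forall>i\<in>\<Omega> N. L2_operator_eq M (\<pi> (s i)) (branch_operator M F (f i)))"

section \<open>Jump transformations and invariant densities\<close>

text \<open>
  The jump transformation is undefined where \<open>A\<close> is never entered, a null set under the standing
  hypothesis on \<open>(T, A)\<close>; it is extended there by the identity.
\<close>

definition first_entry_time :: "('x \<Rightarrow> 'x) \<Rightarrow> 'x set \<Rightarrow> 'x \<Rightarrow> nat" where
  "first_entry_time T A x = (LEAST k. (T ^^ k) x \<in> A)"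

definition jump_transformation :: "('x \<Rightarrow> 'x) \<Rightarrow> 'x set \<Rightarrow> 'x \<Rightarrow> 'x" where
  "jump_transformation T A x =
     (if \<exists>k. (T ^^ k) x \<in> A then (T ^^ (first_entry_time T A x + 1)) x else x)"

definition invariant_measure :: "'x measure \<Rightarrow> ('x \<Rightarrow> 'x) \<Rightarrow> bool" where
  "invariant_measure \<nu> T \<longleftrightarrow>
     T \<in> measurable \<nu> \<nu> \<and> (\<forall>E\<in>sets \<nu>. emeasure \<nu> (T -` E \<inter> space \<nu>) = emeasure \<nu> E)"

definition invariant_density :: "'x measure \<Rightarrow> ('x \<Rightarrow> 'x) \<Rightarrow> ('x \<Rightarrow> real) \<Rightarrow> bool" where
  "invariant_density M T \<phi> \<longleftrightarrow>
     \<phi> \<in> borel_measurable M \<and> (AE x in M. 0 \<le> \<phi> x) \<and>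
     invariant_measure (density M (\<lambda>x. ennreal (\<phi> x))) T"

end

theory Submission
  imports Defs
begin

text \<open>
  The branches are \<open>g\<^sub>n = f\<^sub>2\<^sup>n\<^sup>-\<^sup>1 \<circ> f\<^sub>1\<close>, corrected on a null set where the ranges of \<open>f\<^sub>1\<close> and \<open>f\<^sub>2\<close>
  overlap along the orbit; there \<open>f\<^sub>1\<close>, itself a right inverse of the jump transformation, is used.
  By the chain rule \<open>S(g\<^sub>n) = S(f\<^sub>2)\<^sup>n\<^sup>-\<^sup>1 S(f\<^sub>1)\<close>, so both representations of \<open>O\<^sub>\<infinity>\<close> agree on
  generators, and hence everywhere, because representations are contractive.  No sigma-finiteness is
  available, but essential uniqueness of the positive derivative \<open>\<Phi>\<close> of \<open>\<mu> \<circ> f\<^sub>1\<close> forces the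
  measure to be semifinite, which in turn makes all Radon-Nikodym derivatives involved finite and
  essentially unique.

  For the invariant density, \<open>\<psi> = \<Phi> (\<phi> \<circ> f\<^sub>1)\<close> is the density of \<open>E \<mapsto> \<nu>(f\<^sub>1 E)\<close>.  Invariance of \<open>\<nu>\<close>
  gives \<open>\<nu>(F) = \<nu>(f\<^sub>1 F) + \<nu>(f\<^sub>2 F)\<close>, and for \<open>F = f\<^sub>2\<^sup>n (f\<^sub>1 E)\<close> these identities telescope to
  \<open>(\<Sum>n. \<nu>(f\<^sub>1 (f\<^sub>2\<^sup>n (f\<^sub>1 E)))) = \<nu>(f\<^sub>1 E)\<close>.
\<close>

section \<open>Square integrable functions\<close>

text \<open>A representation is only required to be bounded at each single element, with no constant
  uniform in the element, so agreement on generators does not pass to norm limits for free. The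
  estimate by the norm of the algebra is therefore proved, without spectral theory, from the
  C*-identity and completeness alone. Two levels of precision meet: operators and densities are
  determined up to null sets, whereas a coding map must invert every branch at every point. Hence
  the compositions \<open>f2^(n-1) f1\<close> are altered on null sets, and operators are compared
  through a relation that survives such alterations. Integrability of \<open>\<phi>\<close> enters
  twice: it puts the square root of \<open>\<phi>\<close> into \<open>L2 M\<close>, and it makes the
  remainder of the telescoping sum vanish. That remainder, \<open>\<nu>(f2^n f1 E)\<close>, is the
  term of a series whose sum is the measure of the preimage of \<open>E\<close> under the jump, at
  most the finite total mass of \<open>\<nu>\<close>.\<close>

lemma L2_measurable: "\<phi> \<in> L2 M \<Longrightarrow> \<phi> \<in> borel_measurable M"
  by (simp add: L2_def)

lemma L2_integrable: "\<phi> \<in> L2 M \<Longrightarrow> integrable M (\<lambda>x. (cmod (\<phi> x))\<^sup>2)"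
  by (simp add: L2_def)

lemma borel_measurable_cnj[measurable]:
  "f \<in> borel_measurable M \<Longrightarrow> (\<lambda>x. cnj (f x)) \<in> borel_measurable M"
  using borel_measurable_continuous_onI[OF continuous_on_cnj[OF continuous_on_id]]
  by (rule measurable_compose_rev)

lemma L2_mult_integrable:
  assumes "\<phi> \<in> L2 M" "\<psi> \<in> L2 M"
  shows "integrable M (\<lambda>x. \<phi> x * cnj (\<psi> x))"
proof (rule Bochner_Integration.integrable_bound)
  show "integrable M (\<lambda>x. (cmod (\<phi> x))\<^sup>2 + (cmod (\<psi> x))\<^sup>2)"
    using assms L2_integrable by (intro Bochner_Integration.integrable_add)
  show "(\<lambda>x. \<phi> x * cnj (\<psi> x)) \<in> borel_measurable M"
    using assms[THEN L2_measurable] by measurable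
  have "a * b \<le> a\<^sup>2 + b\<^sup>2" if "0 \<le> a" "0 \<le> b" for a b :: real
    using that sum_squares_bound[of a b] mult_nonneg_nonneg[OF that] by linarith
  then show "AE x in M. norm (\<phi> x * cnj (\<psi> x)) \<le> norm ((cmod (\<phi> x))\<^sup>2 + (cmod (\<psi> x))\<^sup>2)"
    by (auto simp: norm_mult)
qed

text \<open>This single expansion serves the triangle inequality, with \<open>r = 1\<close>, and the
  estimate that improves operator bounds, with \<open>r = 1 / C^2\<close>.\<close>

lemma cmod_diff_scaled_sq:
  "(cmod (z - complex_of_real r * w))\<^sup>2 = (cmod z)\<^sup>2 - 2 * r * Re (z * cnj w) + r\<^sup>2 * (cmod w)\<^sup>2"
  by (simp only: cmod_power2) (simp add: power2_eq_square algebra_simps)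

lemma L2_diff_scaled:
  assumes "\<phi> \<in> L2 M" "\<psi> \<in> L2 M"
  shows "(\<lambda>x. \<phi> x - complex_of_real r * \<psi> x) \<in> L2 M"
  using assms[THEN L2_measurable] assms[THEN L2_integrable] L2_mult_integrable[OF assms]
  by (auto simp: L2_def cmod_diff_scaled_sq simp del: times_complex.sel
      intro!: Bochner_Integration.integrable_add Bochner_Integration.integrable_diff integrable_Re integrable_mult_right)

lemma L2_diff: "\<lbrakk>\<phi> \<in> L2 M; \<psi> \<in> L2 M\<rbrakk> \<Longrightarrow> (\<lambda>x. \<phi> x - \<psi> x) \<in> L2 M"
  using L2_diff_scaled[of \<phi> M \<psi> 1] by simp

lemma L2_norm_nonneg: "0 \<le> L2_norm M \<phi>"
  by (simp add: L2_norm_def)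

lemma L2_norm_sq: "(L2_norm M \<phi>)\<^sup>2 = (LINT x|M. (cmod (\<phi> x))\<^sup>2)"
  by (simp add: L2_norm_def)

lemma L2_norm_cong_AE:
  assumes "\<phi> \<in> L2 M" "\<psi> \<in> L2 M" "AE x in M. \<phi> x = \<psi> x"
  shows "L2_norm M \<phi> = L2_norm M \<psi>"
  unfolding L2_norm_def using assms L2_measurable[OF assms(1)] L2_measurable[OF assms(2)]
  by (intro arg_cong[of _ _ sqrt] integral_cong_AE) auto

lemma L2_inner_cong_AE:
  assumes "\<phi> \<in> L2 M" "\<phi>' \<in> L2 M" "\<psi> \<in> L2 M" "\<psi>' \<in> L2 M"
    and "AE x in M. \<phi> x = \<phi>' x" "AE x in M. \<psi> x = \<psi>' x"
  shows "L2_inner M \<phi> \<psi> = L2_inner M \<phi>' \<psi>'"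
  unfolding L2_inner_def using assms assms(1-4)[THEN L2_measurable]
  by (intro integral_cong_AE) auto

lemma L2_inner_self: "L2_inner M \<phi> \<phi> = complex_of_real ((L2_norm M \<phi>)\<^sup>2)"
  by (simp add: L2_inner_def L2_norm_sq complex_mult_cnj cmod_power2 flip: integral_complex_of_real)

lemma L2_norm_sq_diff_scaled:
  assumes "\<phi> \<in> L2 M" "\<psi> \<in> L2 M"
  shows "(L2_norm M (\<lambda>x. \<phi> x - complex_of_real r * \<psi> x))\<^sup>2 =
    (L2_norm M \<phi>)\<^sup>2 - 2 * r * Re (L2_inner M \<phi> \<psi>) + r\<^sup>2 * (L2_norm M \<psi>)\<^sup>2"
proof -
  note int = assms[THEN L2_integrable] L2_mult_integrable[OF assms]
  have "(LINT x|M. (cmod (\<phi> x - complex_of_real r * \<psi> x))\<^sup>2) =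
      (LINT x|M. (cmod (\<phi> x))\<^sup>2) - (LINT x|M. 2 * r * Re (\<phi> x * cnj (\<psi> x)))
        + (LINT x|M. r\<^sup>2 * (cmod (\<psi> x))\<^sup>2)"
    unfolding cmod_diff_scaled_sq using int integrable_Re[OF int(3)]
    by (subst Bochner_Integration.integral_add Bochner_Integration.integral_diff;
        (intro Bochner_Integration.integrable_diff integrable_mult_right)?)+ auto
  also have "(LINT x|M. 2 * r * Re (\<phi> x * cnj (\<psi> x))) = 2 * r * Re (L2_inner M \<phi> \<psi>)"
    unfolding L2_inner_def integral_Re[OF int(3), symmetric]
    by (rule integral_mult_right_zero)
  finally show ?thesis
    by (simp add: L2_norm_sq)
qed

lemma L2_norm_eq_0_AE:
  assumes "\<phi> \<in> L2 M" "L2_norm M \<phi> = 0"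
  shows "AE x in M. \<phi> x = 0"
proof -
  have "(LINT x|M. (cmod (\<phi> x))\<^sup>2) = 0"
    using assms(2) L2_norm_sq[of M \<phi>] by simp
  then show ?thesis
    using integral_nonneg_eq_0_iff_AE[OF L2_integrable[OF assms(1)]] by simp
qed

text \<open>Integrate the weighted inequality between arithmetic and geometric mean; the weight
  \<open>t\<close>, the ratio of the two norms, makes both terms on the right equal. The ratio needs
  nonzero norms, and if one vanishes the integrand is zero almost everywhere.\<close>

lemma L2_Cauchy_Schwarz:
  assumes "\<phi> \<in> L2 M" "\<psi> \<in> L2 M"
  shows "cmod (L2_inner M \<phi> \<psi>) \<le> L2_norm M \<phi> * L2_norm M \<psi>"
proof (cases "L2_norm M \<phi> = 0 \<or> L2_norm M \<psi> = 0")
  case True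
  then have "AE x in M. \<phi> x * cnj (\<psi> x) = 0"
    using L2_norm_eq_0_AE[OF assms(1)] L2_norm_eq_0_AE[OF assms(2)] by fastforce
  then have "L2_inner M \<phi> \<psi> = 0"
    unfolding L2_inner_def by (rule integral_eq_zero_AE)
  then show ?thesis
    by (simp add: L2_norm_nonneg)
next
  case False
  define t where "t = L2_norm M \<psi> / L2_norm M \<phi>"
  have pos: "0 < L2_norm M \<phi>" "0 < L2_norm M \<psi>"
    using False L2_norm_nonneg[of M] by (auto simp: less_le)
  then have t: "0 < t"
    by (simp add: t_def)
  have amgm: "a * b \<le> t / 2 * a\<^sup>2 + 1 / (2 * t) * b\<^sup>2" for a b :: real
    using zero_le_power2[of "t * a - b"] t by (simp add: field_simps power2_eq_square)
  note int = assms[THEN L2_integrable]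
  have "cmod (L2_inner M \<phi> \<psi>) \<le> (LINT x|M. cmod (\<phi> x * cnj (\<psi> x)))"
    unfolding L2_inner_def by (rule integral_norm_bound)
  also have "\<dots> \<le> (LINT x|M. t / 2 * (cmod (\<phi> x))\<^sup>2 + 1 / (2 * t) * (cmod (\<psi> x))\<^sup>2)"
    using L2_mult_integrable[OF assms] int amgm
    by (intro integral_mono Bochner_Integration.integrable_add integrable_mult_right
        integrable_norm) (auto simp: norm_mult)
  also have "\<dots> = t / 2 * (L2_norm M \<phi>)\<^sup>2 + 1 / (2 * t) * (L2_norm M \<psi>)\<^sup>2"
    using int by (simp add: L2_norm_sq)
  also have "\<dots> = L2_norm M \<phi> * L2_norm M \<psi>"
    using pos by (simp add: t_def field_simps power2_eq_square)
  finally show ?thesis .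
qed

lemma L2_norm_diff_le:
  assumes "\<phi> \<in> L2 M" "\<psi> \<in> L2 M"
  shows "L2_norm M (\<lambda>x. \<phi> x - \<psi> x) \<le> L2_norm M \<phi> + L2_norm M \<psi>"
proof (rule power2_le_imp_le)
  have "- Re (L2_inner M \<phi> \<psi>) \<le> L2_norm M \<phi> * L2_norm M \<psi>"
    using L2_Cauchy_Schwarz[OF assms] abs_Re_le_cmod[of "L2_inner M \<phi> \<psi>"] by linarith
  then show "(L2_norm M (\<lambda>x. \<phi> x - \<psi> x))\<^sup>2 \<le> (L2_norm M \<phi> + L2_norm M \<psi>)\<^sup>2"
    using L2_norm_sq_diff_scaled[OF assms, of 1] by (simp add: power2_sum)
qed (simp add: L2_norm_nonneg)

text \<open>Test with the difference of the two functions. Adjoints are known only through inner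
  products, so this is how they are identified.\<close>

lemma L2_eqI_inner:
  assumes "\<phi> \<in> L2 M" "\<psi> \<in> L2 M"
    and "\<And>\<theta>. \<theta> \<in> L2 M \<Longrightarrow> L2_inner M \<theta> \<phi> = L2_inner M \<theta> \<psi>"
  shows "AE x in M. \<phi> x = \<psi> x"
proof -
  let ?d = "\<lambda>x. \<phi> x - \<psi> x"
  have d: "?d \<in> L2 M"
    using assms by (intro L2_diff)
  have "L2_inner M ?d ?d = (LINT x|M. ?d x * cnj (\<phi> x) - ?d x * cnj (\<psi> x))"
    unfolding L2_inner_def by (simp add: algebra_simps)
  also have "\<dots> = L2_inner M ?d \<phi> - L2_inner M ?d \<psi>"
    unfolding L2_inner_def using assms d
    by (intro Bochner_Integration.integral_diff L2_mult_integrable)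
  finally have "L2_norm M ?d = 0"
    using assms(3)[OF d] by (simp add: L2_inner_self)
  from L2_norm_eq_0_AE[OF d this] show ?thesis
    by simp
qed

section \<open>Representations are contractive\<close>

context unital_cstar_algebra
begin

lemma cscale_minus_one:
  assumes x: "x \<in> carrier A"
  shows "cscale A (-1) x = \<ominus> x"
proof -
  have "cscale A 0 x \<oplus> cscale A 0 x = cscale A 0 x"
    using cscale_add_left[OF x, of 0 0] by simp
  then have "cscale A 0 x = \<zero>"
    using cscale_closed[OF x] by (metis add.l_cancel_one' add.r_cancel_one)
  then have "x \<oplus> cscale A (-1) x = \<zero>"
    using cscale_add_left[OF x, of 1 "-1"] cscale_one[OF x] by simp
  then show ?thesis
    using x cscale_closed by (metis add.inv_comm minus_equality)
qed

lemma cnorm_zero: "cnorm A \<zero> = 0"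
  using cnorm_eq_zero by simp

lemma cnorm_uminus: "x \<in> carrier A \<Longrightarrow> cnorm A (\<ominus> x) = cnorm A x"
  using cnorm_cscale[of x "-1"] by (simp add: cscale_minus_one)

lemma cnorm_one: "cnorm A \<one> = 1"
proof -
  \<comment> \<open>Take adjoints in the identity \<open>1 1* = 1*\<close>.\<close>
  have "cadj A \<one> = \<one>"
    using cadj_mult[of \<one> "cadj A \<one>"] cadj_closed[OF one_closed] cadj_cadj[OF one_closed]
    by simp
  then have "(cnorm A \<one>)\<^sup>2 = cnorm A \<one>"
    using cstar_identity[OF one_closed] by simp
  then show ?thesis
    using cnorm_eq_zero[OF one_closed] one_not_zero by (simp add: power2_eq_square)
qed

lemma cnorm_pow: "x \<in> carrier A \<Longrightarrow> cnorm A (x [^] (n::nat)) \<le> cnorm A x ^ n"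
proof (induction n)
  case (Suc n)
  have "cnorm A (x [^] Suc n) \<le> cnorm A (x [^] n) * cnorm A x"
    using Suc.prems cnorm_mult by simp
  also have "\<dots> \<le> cnorm A x ^ n * cnorm A x"
    using Suc cnorm_nonneg by (intro mult_right_mono) auto
  finally show ?case
    by (simp add: mult.commute)
qed (simp add: cnorm_one)

lemma cnorm_minus_triangle:
  assumes "x \<in> carrier A" "y \<in> carrier A" "z \<in> carrier A"
  shows "cnorm A (x \<ominus> z) \<le> cnorm A (x \<ominus> y) + cnorm A (y \<ominus> z)"
proof -
  have "x \<ominus> z = (x \<ominus> y) \<oplus> (y \<ominus> z)"
    using assms by (simp add: minus_eq a_assoc r_neg1)
  then show ?thesis
    using assms cnorm_triangle[of "x \<ominus> y" "y \<ominus> z"] by simp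
qed

lemma cnorm_minus_commute:
  assumes "x \<in> carrier A" "y \<in> carrier A"
  shows "cnorm A (x \<ominus> y) = cnorm A (y \<ominus> x)"
proof -
  have "\<ominus> (x \<ominus> y) = y \<ominus> x"
    using assms by (simp add: minus_eq minus_add a_comm)
  then show ?thesis
    using assms cnorm_uminus[of "x \<ominus> y"] by simp
qed

text \<open>A left inverse suffices: a representation applied to \<open>b (1 - x) = 1\<close> shows
  that the image of \<open>1 - x\<close> is bounded below.\<close>

lemma Neumann_left_inverse:
  assumes x: "x \<in> carrier A" and less: "cnorm A x < 1"
  shows "\<exists>b\<in>carrier A. b \<otimes> (\<one> \<ominus> x) = \<one>"
proof -
  define q where "q = cnorm A x"
  have q: "0 \<le> q" "q < 1"
    using x less cnorm_nonneg by (auto simp: q_def)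
  define u where "u n = finsum A (\<lambda>k. x [^] k) {..<n}" for n :: nat
  have u[simp]: "u n \<in> carrier A" for n
    using x by (auto simp: u_def intro!: finsum_closed)
  have u_Suc: "u (Suc n) = u n \<oplus> x [^] n" for n
    using x by (simp add: u_def lessThan_Suc a_comm)
  \<comment> \<open>The right-hand side is the exact value of the geometric sum
    \<open>q^n + ... + q^(n+k-1)\<close>; keeping the factor \<open>1 - q^k\<close> lets the
    induction on \<open>k\<close> close.\<close>
  have diff: "cnorm A (u (n + k) \<ominus> u n) \<le> q ^ n / (1 - q) * (1 - q ^ k)" for n k
  proof (induction k)
    case 0
    then show ?case
      using r_neg[OF u] by (simp add: cnorm_zero minus_eq)
  next
    case (Suc k)
    have "u (n + Suc k) \<ominus> u (n + k) = x [^] (n + k)"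
      using x u[of "n + k"] by (simp add: u_Suc minus_eq a_comm[of "u (n + k)"] a_assoc r_neg)
    then have "cnorm A (u (n + Suc k) \<ominus> u n) \<le> q ^ (n + k) + cnorm A (u (n + k) \<ominus> u n)"
      using cnorm_minus_triangle[of "u (n + Suc k)" "u (n + k)" "u n"] cnorm_pow[OF x, of "n + k"]
      by (simp add: q_def)
    also have "\<dots> \<le> q ^ (n + k) + q ^ n / (1 - q) * (1 - q ^ k)"
      using Suc by simp
    also have "\<dots> = q ^ n / (1 - q) * (1 - q ^ Suc k)"
      using q by (simp add: field_simps power_add)
    finally show ?case .
  qed
  have diff': "cnorm A (u m \<ominus> u n) \<le> q ^ N / (1 - q)" if "N \<le> n" "N \<le> m" for m n N
  proof -
    have *: "cnorm A (u m \<ominus> u n) \<le> q ^ N / (1 - q)" if "N \<le> n" "n \<le> m" for m n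
    proof -
      have "cnorm A (u m \<ominus> u n) \<le> q ^ n / (1 - q) * (1 - q ^ (m - n))"
        using diff[of n "m - n"] that by simp
      also have "\<dots> \<le> q ^ n / (1 - q) * 1"
        using q by (intro mult_left_mono) auto
      also have "\<dots> \<le> q ^ N / (1 - q)"
        using q that by (auto intro!: divide_right_mono power_decreasing)
      finally show ?thesis .
    qed
    show ?thesis
      using *[of n m] *[of m n] that cnorm_minus_commute[of "u m" "u n"]
      by (cases "n \<le> m") auto
  qed
  have lim: "(\<lambda>N. q ^ N / (1 - q)) \<longlonglongrightarrow> 0"
    using q by (intro tendsto_divide_zero LIMSEQ_power_zero) auto
  have "\<exists>K. \<forall>m\<ge>K. \<forall>n\<ge>K. cnorm A (u m \<ominus> u n) < e" if e: "0 < e" for e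
  proof -
    obtain N where "q ^ N / (1 - q) < e"
      using order_tendstoD(2)[OF lim e] by (auto simp: eventually_sequentially)
    then show ?thesis
      using diff'[of N] by (meson le_less_trans)
  qed
  with cnorm_complete[of u] obtain b where b: "b \<in> carrier A"
    and conv: "(\<lambda>n. cnorm A (u n \<ominus> b)) \<longlonglongrightarrow> 0"
    by auto
  have tele: "u n \<otimes> (\<one> \<ominus> x) = \<one> \<ominus> x [^] n" for n
  proof (induction n)
    case 0
    then show ?case
      using x by (simp add: u_def minus_eq r_neg)
  next
    case (Suc n)
    have "u (Suc n) \<otimes> (\<one> \<ominus> x) = (\<one> \<ominus> x [^] n) \<oplus> x [^] n \<otimes> (\<one> \<ominus> x)"
      using x Suc by (simp add: u_Suc l_distr)
    also have "x [^] n \<otimes> (\<one> \<ominus> x) = x [^] n \<ominus> x [^] Suc n"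
      using x by (simp add: minus_eq r_distr r_minus)
    also have "(\<one> \<ominus> x [^] n) \<oplus> (x [^] n \<ominus> x [^] Suc n) = \<one> \<ominus> x [^] Suc n"
      using x by (simp add: minus_eq a_assoc r_neg1)
    finally show ?case .
  qed
  let ?y = "\<one> \<ominus> x"
  have y: "?y \<in> carrier A"
    using x by simp
  \<comment> \<open>The algebra carries a norm but no topology on its type, so the limit in
    \<open>u n (1 - x) = 1 - x^n\<close> is taken through a numerical bound, from
    \<open>b y - 1 = (b - u n) y + (u n y - 1)\<close>.\<close>
  have bound: "cnorm A (b \<otimes> ?y \<ominus> \<one>) \<le> cnorm A (u n \<ominus> b) * cnorm A ?y + q ^ n" for n
  proof -
    have "b \<otimes> ?y \<ominus> u n \<otimes> ?y = (b \<ominus> u n) \<otimes> ?y"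
      using b y by (simp add: minus_eq l_distr l_minus)
    then have "cnorm A (b \<otimes> ?y \<ominus> u n \<otimes> ?y) \<le> cnorm A (u n \<ominus> b) * cnorm A ?y"
      using cnorm_mult[of "b \<ominus> u n" ?y] b y cnorm_minus_commute[of b "u n"] by simp
    moreover have "u n \<otimes> ?y \<ominus> \<one> = \<ominus> (x [^] n)"
      unfolding tele using x by (simp add: minus_eq a_comm[of \<one>] a_assoc r_neg)
    then have "cnorm A (u n \<otimes> ?y \<ominus> \<one>) \<le> q ^ n"
      using x cnorm_pow[OF x, of n] by (simp add: cnorm_uminus q_def)
    moreover have "cnorm A (b \<otimes> ?y \<ominus> \<one>) \<le>
        cnorm A (b \<otimes> ?y \<ominus> u n \<otimes> ?y) + cnorm A (u n \<otimes> ?y \<ominus> \<one>)"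
      using b y by (intro cnorm_minus_triangle) auto
    ultimately show ?thesis
      by linarith
  qed
  have "(\<lambda>n. cnorm A (u n \<ominus> b) * cnorm A ?y + q ^ n) \<longlonglongrightarrow> 0 * cnorm A ?y + 0"
    using q conv by (intro tendsto_intros LIMSEQ_power_zero) auto
  then have "cnorm A (b \<otimes> ?y \<ominus> \<one>) \<le> 0"
    using bound by (intro LIMSEQ_le_const[of _ 0]) auto
  then have "b \<otimes> ?y \<ominus> \<one> = \<zero>"
    using cnorm_nonneg[of "b \<otimes> ?y \<ominus> \<one>"] cnorm_eq_zero[of "b \<otimes> ?y \<ominus> \<one>"] b y by simp
  then have "b \<otimes> ?y = \<one>"
    using b y minus_equality[of "b \<otimes> ?y" "\<ominus> \<one>"] by (simp add: minus_eq)
  then show ?thesis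
    using b by blast
qed

end

section \<open>Optimal bounds for the operators of a representation\<close>

lemma L2_representationD:
  assumes "L2_representation A M \<pi>" "a \<in> carrier A" "b \<in> carrier A" "\<phi> \<in> L2 M"
  shows "\<pi> a \<phi> \<in> L2 M"
    and "\<psi> \<in> L2 M \<Longrightarrow> AE x in M. \<phi> x = \<psi> x \<Longrightarrow> AE x in M. \<pi> a \<phi> x = \<pi> a \<psi> x"
    and "AE x in M. \<pi> (a \<oplus>\<^bsub>A\<^esub> b) \<phi> x = \<pi> a \<phi> x + \<pi> b \<phi> x"
    and "AE x in M. \<pi> (cscale A c a) \<phi> x = c * \<pi> a \<phi> x"
    and "AE x in M. \<pi> (a \<otimes>\<^bsub>A\<^esub> b) \<phi> x = \<pi> a (\<pi> b \<phi>) x"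
    and "AE x in M. \<pi> \<one>\<^bsub>A\<^esub> \<phi> x = \<phi> x"
    and "\<psi> \<in> L2 M \<Longrightarrow> L2_inner M (\<pi> a \<phi>) \<psi> = L2_inner M \<phi> (\<pi> (cadj A a) \<psi>)"
  using assms by (auto simp: L2_representation_def L2_operator_eq_def L2_bounded_operator_def)

text \<open>The constant is raised to at least 1 so that it is positive and
  \<open>1 / (2 * D^2)\<close> lies strictly between 0 and 1 below.\<close>

lemma L2_representation_bound:
  assumes "L2_representation A M \<pi>" "a \<in> carrier A"
  obtains C where "1 \<le> C" "\<And>\<phi>. \<phi> \<in> L2 M \<Longrightarrow> L2_norm M (\<pi> a \<phi>) \<le> C * L2_norm M \<phi>"
proof -
  have "L2_bounded_operator M (\<pi> a)"
    using assms by (simp add: L2_representation_def)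
  then obtain C where C: "\<And>\<phi>. \<phi> \<in> L2 M \<Longrightarrow> L2_norm M (\<pi> a \<phi>) \<le> C * L2_norm M \<phi>"
    unfolding L2_bounded_operator_def by blast
  have "L2_norm M (\<pi> a \<phi>) \<le> max 1 C * L2_norm M \<phi>" if "\<phi> \<in> L2 M" for \<phi>
    using C[OF that] mult_right_mono[of C "max 1 C" "L2_norm M \<phi>"] L2_norm_nonneg[of M \<phi>] by simp
  then show ?thesis
    using that[of "max 1 C"] by simp
qed

context unital_cstar_algebra
begin

lemma L2_representation_minus:
  assumes \<pi>: "L2_representation A M \<pi>" and a: "a \<in> carrier A" and b: "b \<in> carrier A"
    and \<phi>: "\<phi> \<in> L2 M"
  shows "AE x in M. \<pi> (a \<ominus> b) \<phi> x = \<pi> a \<phi> x - \<pi> b \<phi> x"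
proof -
  have diff: "a \<ominus> b = a \<oplus> cscale A (-1) b"
    using a b by (simp add: cscale_minus_one minus_eq)
  show ?thesis
    using L2_representationD(3)[OF \<pi> a cscale_closed[OF b, of "-1"] \<phi>]
      L2_representationD(4)[OF \<pi> b a \<phi>, of "-1"]
    unfolding diff by eventually_elim simp
qed

text \<open>With \<open>\<theta>\<close> the vector \<open>\<pi> (cadj A a) \<psi>\<close>, the
  square of its norm is the inner product of \<open>\<pi> a \<theta>\<close> and
  \<open>\<psi>\<close>, at most \<open>C\<close> times both norms; one factor, the norm of
  \<open>\<theta>\<close>, cancels unless it is zero.\<close>

lemma L2_representation_adjoint_bound:
  assumes \<pi>: "L2_representation A M \<pi>" and a: "a \<in> carrier A"
    and C: "0 \<le> C" "\<And>\<phi>. \<phi> \<in> L2 M \<Longrightarrow> L2_norm M (\<pi> a \<phi>) \<le> C * L2_norm M \<phi>"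
    and \<psi>: "\<psi> \<in> L2 M"
  shows "L2_norm M (\<pi> (cadj A a) \<psi>) \<le> C * L2_norm M \<psi>"
proof (cases "L2_norm M (\<pi> (cadj A a) \<psi>) = 0")
  case True
  then show ?thesis
    using C(1) L2_norm_nonneg[of M \<psi>] by simp
next
  case False
  let ?\<theta> = "\<pi> (cadj A a) \<psi>"
  have \<theta>: "?\<theta> \<in> L2 M"
    using L2_representationD(1)[OF \<pi> cadj_closed[OF a] a \<psi>] .
  have "complex_of_real ((L2_norm M ?\<theta>)\<^sup>2) = L2_inner M (\<pi> a ?\<theta>) \<psi>"
    using L2_representationD(7)[OF \<pi> a a \<theta> \<psi>] L2_inner_self[of M ?\<theta>] by simp
  then have "(L2_norm M ?\<theta>)\<^sup>2 \<le> L2_norm M (\<pi> a ?\<theta>) * L2_norm M \<psi>"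
    using L2_Cauchy_Schwarz[OF L2_representationD(1)[OF \<pi> a a \<theta>] \<psi>]
    by (metis norm_of_real abs_of_nonneg zero_le_power2)
  also have "\<dots> \<le> C * L2_norm M ?\<theta> * L2_norm M \<psi>"
    using C(2)[OF \<theta>] L2_norm_nonneg by (intro mult_right_mono)
  finally have "L2_norm M ?\<theta> * L2_norm M ?\<theta> \<le> L2_norm M ?\<theta> * (C * L2_norm M \<psi>)"
    by (simp add: power2_eq_square algebra_simps)
  then show ?thesis
    using False L2_norm_nonneg[of M ?\<theta>] by (simp add: mult_le_cancel_left)
qed

text \<open>
  A bound \<open>C > \<parallel>a\<parallel>\<close> is never optimal: \<open>1 - a*a / C\<^sup>2\<close> is left invertible by the Neumann series,
  so its image under the representation is bounded below.
\<close>

lemma L2_representation_improve_bound: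
  assumes \<pi>: "L2_representation A M \<pi>" and a: "a \<in> carrier A"
    and C: "cnorm A a < C" "\<And>\<phi>. \<phi> \<in> L2 M \<Longrightarrow> L2_norm M (\<pi> a \<phi>) \<le> C * L2_norm M \<phi>"
  shows "\<exists>C'<C. 0 \<le> C' \<and> (\<forall>\<phi>\<in>L2 M. L2_norm M (\<pi> a \<phi>) \<le> C' * L2_norm M \<phi>)"
proof -
  have C0: "0 < C"
    using C(1) cnorm_nonneg[OF a] by linarith
  define r where "r = 1 / C\<^sup>2"
  have r: "0 < r"
    using C0 by (simp add: r_def)
  define h where "h = cadj A a \<otimes> a"
  have h: "h \<in> carrier A"
    using a cadj_closed by (simp add: h_def)
  define x where "x = cscale A (complex_of_real r) h"
  have x: "x \<in> carrier A"
    using h cscale_closed by (simp add: x_def)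
  have "cnorm A x = (cnorm A a / C)\<^sup>2"
    using cnorm_cscale[OF h, of "complex_of_real r"] r cstar_identity[OF a]
    by (simp add: x_def h_def[symmetric] power_divide) (simp add: r_def)
  also have "\<dots> < 1"
    using C(1) C0 cnorm_nonneg[OF a] by (simp add: power_less_one_iff abs_square_less_1)
  finally obtain b where b: "b \<in> carrier A" and inv: "b \<otimes> (\<one> \<ominus> x) = \<one>"
    using Neumann_left_inverse[OF x] by blast
  obtain D where D: "1 \<le> D" "\<And>\<phi>. \<phi> \<in> L2 M \<Longrightarrow> L2_norm M (\<pi> b \<phi>) \<le> D * L2_norm M \<phi>"
    using L2_representation_bound[OF \<pi> b] by blast
  \<comment> \<open>Write \<open>T\<close> for \<open>\<pi> a \<phi>\<close> and \<open>H\<close>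
    for the adjoint applied to it. The norm of \<open>H\<close> is at most \<open>C^2\<close> times
    that of \<open>\<phi>\<close>, and \<open>r^2 C^4 = 1\<close>, so expanding
    \<open>\<phi> - r H\<close> bounds its squared norm by twice the squared norm of
    \<open>\<phi>\<close> minus \<open>r\<close> times that of \<open>T\<close>. The left inverse
    bounds it below by the squared norm of \<open>\<phi>\<close> over \<open>D^2\<close>. Solving
    for the norm of \<open>T\<close> gives \<open>C'\<close>.\<close>
  define C' where "C' = C * sqrt (1 - 1 / (2 * D\<^sup>2))"
  have "1 < 2 * D\<^sup>2"
    using one_le_power[OF D(1), of 2] by linarith
  then have D2: "0 < 1 / (2 * D\<^sup>2)" "1 / (2 * D\<^sup>2) < 1"
    using D(1) by simp_all
  have "C' < C" "0 \<le> C'"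
    using D2 C0 by (auto simp: C'_def)
  moreover have "L2_norm M (\<pi> a \<phi>) \<le> C' * L2_norm M \<phi>" if \<phi>: "\<phi> \<in> L2 M" for \<phi>
  proof (rule power2_le_imp_le)
    let ?T = "\<pi> a \<phi>" and ?H = "\<pi> (cadj A a) (\<pi> a \<phi>)"
    have T: "?T \<in> L2 M"
      using L2_representationD(1)[OF \<pi> a a \<phi>] .
    have H: "?H \<in> L2 M"
      using L2_representationD(1)[OF \<pi> cadj_closed[OF a] a T] .
    have H_le: "L2_norm M ?H \<le> C * L2_norm M ?T"
      using L2_representation_adjoint_bound[OF \<pi> a _ C(2) T] C0 by simp
    have y: "\<pi> (\<one> \<ominus> x) \<phi> \<in> L2 M"
      using L2_representationD(1)[OF \<pi> _ a \<phi>] x by simp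
    have AE_y: "AE z in M. \<pi> (\<one> \<ominus> x) \<phi> z = \<phi> z - complex_of_real r * ?H z"
      using L2_representation_minus[OF \<pi> one_closed x \<phi>]
        L2_representationD(4)[OF \<pi> h a \<phi>, of "complex_of_real r"]
        L2_representationD(5)[OF \<pi> cadj_closed[OF a] a \<phi>] L2_representationD(6)[OF \<pi> a a \<phi>]
      unfolding x_def[symmetric] h_def[symmetric] by eventually_elim simp
    have "L2_norm M \<phi> = L2_norm M (\<pi> b (\<pi> (\<one> \<ominus> x) \<phi>))"
    proof (rule L2_norm_cong_AE[OF \<phi> L2_representationD(1)[OF \<pi> b a y]])
      have "AE z in M. \<pi> (b \<otimes> (\<one> \<ominus> x)) \<phi> z = \<pi> b (\<pi> (\<one> \<ominus> x) \<phi>) z"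
        using L2_representationD(5)[OF \<pi> b _ \<phi>, of "\<one> \<ominus> x"] x by simp
      then show "AE z in M. \<phi> z = \<pi> b (\<pi> (\<one> \<ominus> x) \<phi>) z"
        using L2_representationD(6)[OF \<pi> a a \<phi>] unfolding inv by eventually_elim simp
    qed
    also have "\<dots> \<le> D * L2_norm M (\<pi> (\<one> \<ominus> x) \<phi>)"
      using D(2)[OF y] .
    \<comment> \<open>The image of \<open>1 - x\<close> equals the explicit combination only almost
      everywhere, which is enough for norms.\<close>
    also have "L2_norm M (\<pi> (\<one> \<ominus> x) \<phi>) = L2_norm M (\<lambda>z. \<phi> z - complex_of_real r * ?H z)"
      using L2_norm_cong_AE[OF y L2_diff_scaled[OF \<phi> H] AE_y] .
    finally have "(L2_norm M \<phi>)\<^sup>2 \<le> D\<^sup>2 * (L2_norm M (\<lambda>z. \<phi> z - complex_of_real r * ?H z))\<^sup>2"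
      using power_mono[of "L2_norm M \<phi>" _ 2] L2_norm_nonneg[of M \<phi>]
      by (metis power_mult_distrib)
    also have "(L2_norm M (\<lambda>z. \<phi> z - complex_of_real r * ?H z))\<^sup>2 =
        (L2_norm M \<phi>)\<^sup>2 - 2 * r * (L2_norm M ?T)\<^sup>2 + r\<^sup>2 * (L2_norm M ?H)\<^sup>2"
      unfolding L2_norm_sq_diff_scaled[OF \<phi> H] L2_representationD(7)[OF \<pi> a a \<phi> T, symmetric]
        L2_inner_self by simp
    also have "\<dots> \<le> (L2_norm M \<phi>)\<^sup>2 - 2 * r * (L2_norm M ?T)\<^sup>2 + r\<^sup>2 * (C * (C * L2_norm M \<phi>))\<^sup>2"
    proof -
      have "L2_norm M ?H \<le> C * (C * L2_norm M \<phi>)"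
        using H_le C(2)[OF \<phi>] C0 by (meson mult_left_mono order_trans less_imp_le)
      then show ?thesis
        using r by (intro add_left_mono mult_left_mono power_mono L2_norm_nonneg) auto
    qed
    also have "\<dots> = 2 * ((L2_norm M \<phi>)\<^sup>2 - r * (L2_norm M ?T)\<^sup>2)"
      using C0 by (simp add: r_def field_simps power2_eq_square)
    finally have "(L2_norm M \<phi>)\<^sup>2 \<le> D\<^sup>2 * (2 * ((L2_norm M \<phi>)\<^sup>2 - r * (L2_norm M ?T)\<^sup>2))"
      using D(1) by (simp add: mult_left_mono)
    then have "(L2_norm M \<phi>)\<^sup>2 / (2 * D\<^sup>2) \<le> (L2_norm M \<phi>)\<^sup>2 - r * (L2_norm M ?T)\<^sup>2"
      using D(1) by (simp add: field_simps)
    then have "r * (L2_norm M ?T)\<^sup>2 \<le> (1 - 1 / (2 * D\<^sup>2)) * (L2_norm M \<phi>)\<^sup>2"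
      by (simp add: algebra_simps)
    then have "(L2_norm M ?T)\<^sup>2 \<le> C\<^sup>2 * ((1 - 1 / (2 * D\<^sup>2)) * (L2_norm M \<phi>)\<^sup>2)"
      using C0 by (simp add: r_def pos_divide_le_eq mult.commute)
    also have "\<dots> = (C' * L2_norm M \<phi>)\<^sup>2"
      using D2 by (simp add: C'_def power_mult_distrib)
    finally show "(L2_norm M ?T)\<^sup>2 \<le> (C' * L2_norm M \<phi>)\<^sup>2" .
  qed (use \<open>0 \<le> C'\<close> in \<open>simp add: L2_norm_nonneg\<close>)
  ultimately show ?thesis
    by blast
qed

text \<open>The infimum of all admissible bounds is again admissible, so it cannot exceed the norm
  of \<open>a\<close>: otherwise the preceding lemma would supply a strictly smaller admissible
  bound.\<close>

lemma L2_representation_contractive: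
  assumes \<pi>: "L2_representation A M \<pi>" and a: "a \<in> carrier A" and \<phi>: "\<phi> \<in> L2 M"
  shows "L2_norm M (\<pi> a \<phi>) \<le> cnorm A a * L2_norm M \<phi>"
proof -
  define S where "S = {C. 0 \<le> C \<and> (\<forall>\<phi>\<in>L2 M. L2_norm M (\<pi> a \<phi>) \<le> C * L2_norm M \<phi>)}"
  obtain C where "1 \<le> C" "\<And>\<phi>. \<phi> \<in> L2 M \<Longrightarrow> L2_norm M (\<pi> a \<phi>) \<le> C * L2_norm M \<phi>"
    using L2_representation_bound[OF \<pi> a] by blast
  then have "C \<in> S"
    by (simp add: S_def)
  then have ne: "S \<noteq> {}"
    by blast
  have bdd: "bdd_below S"
    by (auto simp: S_def)
  have Inf0: "0 \<le> Inf S"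
    using ne by (intro cInf_greatest) (auto simp: S_def)
  have Inf_bound: "L2_norm M (\<pi> a \<phi>) \<le> Inf S * L2_norm M \<phi>" if "\<phi> \<in> L2 M" for \<phi>
  proof (cases "L2_norm M \<phi> = 0")
    case True
    then show ?thesis
      using \<open>C \<in> S\<close> that by (auto simp: S_def)
  next
    case False
    then have pos: "0 < L2_norm M \<phi>"
      using L2_norm_nonneg[of M \<phi>] by linarith
    have "L2_norm M (\<pi> a \<phi>) / L2_norm M \<phi> \<le> Inf S"
      using ne pos that by (intro cInf_greatest) (auto simp: S_def pos_divide_le_eq)
    then show ?thesis
      using pos by (simp add: pos_divide_le_eq)
  qed
  have "Inf S \<le> cnorm A a"
  proof (rule ccontr)
    assume "\<not> Inf S \<le> cnorm A a"
    then obtain C' where "C' < Inf S" "C' \<in> S"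
      using L2_representation_improve_bound[OF \<pi> a _ Inf_bound] by (auto simp: S_def)
    then show False
      using cInf_lower[OF _ bdd, of C'] by simp
  qed
  then show ?thesis
    using Inf_bound[OF \<phi>] mult_right_mono[of "Inf S" "cnorm A a" "L2_norm M \<phi>"]
      L2_norm_nonneg[of M \<phi>] by linarith
qed

section \<open>Representations that agree on generators\<close>

lemma closed_star_subalgebra_representation_eq:
  assumes \<pi>: "L2_representation A M \<pi>" and \<rho>: "L2_representation A M \<rho>"
  shows "closed_star_subalgebra A {a \<in> carrier A. L2_operator_eq M (\<pi> a) (\<rho> a)}"
    (is "closed_star_subalgebra A ?B")
  unfolding closed_star_subalgebra_def
proof (intro conjI ballI allI impI)
  show "?B \<subseteq> carrier A"
    by blast
  show "\<one> \<in> ?B"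
  proof -
    have "AE x in M. \<pi> \<one> \<phi> x = \<rho> \<one> \<phi> x" if \<phi>: "\<phi> \<in> L2 M" for \<phi>
      using L2_representationD(6)[OF \<pi> one_closed one_closed \<phi>]
        L2_representationD(6)[OF \<rho> one_closed one_closed \<phi>]
      by eventually_elim simp
    then show ?thesis
      by (simp add: L2_operator_eq_def)
  qed
next
  fix a b assume ab: "a \<in> ?B" "b \<in> ?B"
  then have a: "a \<in> carrier A" and b: "b \<in> carrier A"
    and eq: "\<And>\<phi>. \<phi> \<in> L2 M \<Longrightarrow> AE x in M. \<pi> a \<phi> x = \<rho> a \<phi> x"
      "\<And>\<phi>. \<phi> \<in> L2 M \<Longrightarrow> AE x in M. \<pi> b \<phi> x = \<rho> b \<phi> x"
    by (auto simp: L2_operator_eq_def)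
  have "AE x in M. \<pi> (a \<oplus> b) \<phi> x = \<rho> (a \<oplus> b) \<phi> x" if \<phi>: "\<phi> \<in> L2 M" for \<phi>
    using L2_representationD(3)[OF \<pi> a b \<phi>] L2_representationD(3)[OF \<rho> a b \<phi>] eq[OF \<phi>]
    by eventually_elim simp
  then show "a \<oplus> b \<in> ?B"
    using ab by (simp add: L2_operator_eq_def)
  have "AE x in M. \<pi> (a \<otimes> b) \<phi> x = \<rho> (a \<otimes> b) \<phi> x" if \<phi>: "\<phi> \<in> L2 M" for \<phi>
  proof -
    have L2: "\<pi> b \<phi> \<in> L2 M" "\<rho> b \<phi> \<in> L2 M"
      using L2_representationD(1)[OF \<pi> b b \<phi>] L2_representationD(1)[OF \<rho> b b \<phi>] by auto
    show ?thesis
      using L2_representationD(2)[OF \<pi> a b L2 eq(2)[OF \<phi>]] eq(1)[OF L2(2)]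
        L2_representationD(5)[OF \<pi> a b \<phi>] L2_representationD(5)[OF \<rho> a b \<phi>]
      by eventually_elim simp
  qed
  then show "a \<otimes> b \<in> ?B"
    using ab by (simp add: L2_operator_eq_def)
next
  fix c a assume "a \<in> ?B"
  then have a: "a \<in> carrier A"
    and eq: "\<And>\<phi>. \<phi> \<in> L2 M \<Longrightarrow> AE x in M. \<pi> a \<phi> x = \<rho> a \<phi> x"
    by (auto simp: L2_operator_eq_def)
  have "AE x in M. \<pi> (cscale A c a) \<phi> x = \<rho> (cscale A c a) \<phi> x" if \<phi>: "\<phi> \<in> L2 M" for \<phi>
    using L2_representationD(4)[OF \<pi> a a \<phi>, of c] L2_representationD(4)[OF \<rho> a a \<phi>, of c] eq[OF \<phi>]
    by eventually_elim simp
  then show "cscale A c a \<in> ?B"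
    using a by (simp add: L2_operator_eq_def cscale_closed)
next
  fix a assume "a \<in> ?B"
  then have a: "a \<in> carrier A" and eq: "L2_operator_eq M (\<pi> a) (\<rho> a)"
    by auto
  \<comment> \<open>Both functions have the same inner products with all of \<open>L2 M\<close>,
    since the adjoints can be moved back to \<open>\<pi> a\<close> and \<open>\<rho> a\<close>,
    which agree.\<close>
  have "AE x in M. \<pi> (cadj A a) \<phi> x = \<rho> (cadj A a) \<phi> x" if \<phi>: "\<phi> \<in> L2 M" for \<phi>
  proof (rule L2_eqI_inner)
    show "\<pi> (cadj A a) \<phi> \<in> L2 M" "\<rho> (cadj A a) \<phi> \<in> L2 M"
      using L2_representationD(1)[OF \<pi> cadj_closed[OF a] a \<phi>]
        L2_representationD(1)[OF \<rho> cadj_closed[OF a] a \<phi>] by auto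
    show "L2_inner M \<theta> (\<pi> (cadj A a) \<phi>) = L2_inner M \<theta> (\<rho> (cadj A a) \<phi>)" if \<theta>: "\<theta> \<in> L2 M" for \<theta>
    proof -
      have "L2_inner M (\<pi> a \<theta>) \<phi> = L2_inner M (\<rho> a \<theta>) \<phi>"
        using L2_inner_cong_AE[OF L2_representationD(1)[OF \<pi> a a \<theta>]
            L2_representationD(1)[OF \<rho> a a \<theta>] \<phi> \<phi>] eq \<theta> by (auto simp: L2_operator_eq_def)
      then show ?thesis
        using L2_representationD(7)[OF \<pi> a a \<theta> \<phi>] L2_representationD(7)[OF \<rho> a a \<theta> \<phi>] by simp
    qed
  qed
  then show "cadj A a \<in> ?B"
    using a by (simp add: L2_operator_eq_def cadj_closed)
next
  fix u l assume u: "(\<forall>n. u n \<in> ?B) \<and> l \<in> carrier A \<and> (\<lambda>n::nat. cnorm A (u n \<ominus> l)) \<longlonglongrightarrow> 0"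
  then have l: "l \<in> carrier A" and un: "u n \<in> carrier A"
    and eq: "L2_operator_eq M (\<pi> (u n)) (\<rho> (u n))"
    and lim: "(\<lambda>n::nat. cnorm A (u n \<ominus> l)) \<longlonglongrightarrow> 0" for n
    by auto
  have "AE x in M. \<pi> l \<phi> x = \<rho> l \<phi> x" if \<phi>: "\<phi> \<in> L2 M" for \<phi>
  proof -
    let ?d = "\<lambda>x. \<pi> l \<phi> x - \<rho> l \<phi> x"
    have L2: "\<pi> l \<phi> \<in> L2 M" "\<rho> l \<phi> \<in> L2 M"
      using L2_representationD(1)[OF \<pi> l l \<phi>] L2_representationD(1)[OF \<rho> l l \<phi>] by auto
    then have d: "?d \<in> L2 M"
      by (rule L2_diff)
    have bound: "L2_norm M ?d \<le> 2 * cnorm A (u n \<ominus> l) * L2_norm M \<phi>" for n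
    proof -
      let ?w = "u n \<ominus> l"
      have w: "?w \<in> carrier A"
        using un l by simp
      have L2w: "\<pi> ?w \<phi> \<in> L2 M" "\<rho> ?w \<phi> \<in> L2 M"
        using L2_representationD(1)[OF \<pi> w l \<phi>] L2_representationD(1)[OF \<rho> w l \<phi>] by auto
      have "AE x in M. \<pi> (u n) \<phi> x = \<rho> (u n) \<phi> x"
        using eq \<phi> by (auto simp: L2_operator_eq_def)
      \<comment> \<open>Since the representations agree at \<open>u n\<close>, their difference at
        \<open>l\<close> is minus their difference at \<open>u n - l\<close>, and contractivity
        makes the latter small.\<close>
      then have "AE x in M. ?d x = \<rho> ?w \<phi> x - \<pi> ?w \<phi> x"
        using L2_representation_minus[OF \<pi> un[of n] l \<phi>] L2_representation_minus[OF \<rho> un[of n] l \<phi>]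
        by eventually_elim simp
      then have "L2_norm M ?d = L2_norm M (\<lambda>x. \<rho> ?w \<phi> x - \<pi> ?w \<phi> x)"
        using d L2w by (intro L2_norm_cong_AE L2_diff[of "\<rho> ?w \<phi>"])
      also have "\<dots> \<le> L2_norm M (\<rho> ?w \<phi>) + L2_norm M (\<pi> ?w \<phi>)"
        using L2w by (intro L2_norm_diff_le)
      also have "\<dots> \<le> cnorm A ?w * L2_norm M \<phi> + cnorm A ?w * L2_norm M \<phi>"
        using w \<phi> \<pi> \<rho> by (intro add_mono L2_representation_contractive)
      finally show ?thesis
        by (simp add: mult.commute)
    qed
    have "(\<lambda>n. 2 * cnorm A (u n \<ominus> l) * L2_norm M \<phi>) \<longlonglongrightarrow> 2 * 0 * L2_norm M \<phi>"
      using lim by (intro tendsto_intros)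
    then have "L2_norm M ?d \<le> 0"
      using bound by (intro LIMSEQ_le_const[of _ 0]) auto
    then have "L2_norm M ?d = 0"
      using L2_norm_nonneg[of M ?d] by simp
    from L2_norm_eq_0_AE[OF d this] show ?thesis
      by simp
  qed
  then show "l \<in> ?B"
    using l by (simp add: L2_operator_eq_def)
qed

lemma L2_representations_eqI:
  assumes "L2_representation A M \<pi>" "L2_representation A M \<rho>" "generates_cstar A S"
    and "\<And>s. s \<in> S \<Longrightarrow> L2_operator_eq M (\<pi> s) (\<rho> s)" and "a \<in> carrier A"
  shows "L2_operator_eq M (\<pi> a) (\<rho> a)"
proof -
  have "S \<subseteq> carrier A"
    using assms(3) by (simp add: generates_cstar_def)
  then have "S \<subseteq> {a \<in> carrier A. L2_operator_eq M (\<pi> a) (\<rho> a)}"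
    using assms(4) by blast
  then have "{a \<in> carrier A. L2_operator_eq M (\<pi> a) (\<rho> a)} = carrier A"
    using assms(3) closed_star_subalgebra_representation_eq[OF assms(1,2)]
    unfolding generates_cstar_def by blast
  then show ?thesis
    using assms(5) by blast
qed

end

text \<open>It makes the restriction to the embedded algebra a representation in its own right, so
  that it can be compared with any other one on generators.\<close>

lemma L2_representation_comp:
  assumes \<pi>: "L2_representation A M \<pi>" and hom: "unital_star_hom B A h"
  shows "L2_representation B M (\<lambda>b. \<pi> (h b))"
proof -
  have h: "h b \<in> carrier A" if "b \<in> carrier B" for b
    using hom that by (auto simp: unital_star_hom_def)
  have add: "h (a \<oplus>\<^bsub>B\<^esub> b) = h a \<oplus>\<^bsub>A\<^esub> h b"
    and mult: "h (a \<otimes>\<^bsub>B\<^esub> b) = h a \<otimes>\<^bsub>A\<^esub> h b"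
    if "a \<in> carrier B" "b \<in> carrier B" for a b
    using hom that by (auto simp: unital_star_hom_def)
  have scale: "h (cscale B c a) = cscale A c (h a)" and adj: "h (cadj B a) = cadj A (h a)"
    if "a \<in> carrier B" for a c
    using hom that by (auto simp: unital_star_hom_def)
  have one: "h \<one>\<^bsub>B\<^esub> = \<one>\<^bsub>A\<^esub>"
    using hom by (auto simp: unital_star_hom_def)
  show ?thesis
    unfolding L2_representation_def L2_operator_eq_def comp_def id_def one
  proof (intro conjI ballI allI)
    show "L2_bounded_operator M (\<pi> (h b))" if "b \<in> carrier B" for b
      using \<pi> h[OF that] by (simp add: L2_representation_def)
  next
    fix a b \<phi> assume ab: "a \<in> carrier B" "b \<in> carrier B" and \<phi>: "\<phi> \<in> L2 M"
    show "AE x in M. \<pi> (h (a \<oplus>\<^bsub>B\<^esub> b)) \<phi> x = \<pi> (h a) \<phi> x + \<pi> (h b) \<phi> x"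
      unfolding add[OF ab] by (rule L2_representationD(3)[OF \<pi> h[OF ab(1)] h[OF ab(2)] \<phi>])
    show "AE x in M. \<pi> (h (a \<otimes>\<^bsub>B\<^esub> b)) \<phi> x = \<pi> (h a) (\<pi> (h b) \<phi>) x"
      unfolding mult[OF ab] by (rule L2_representationD(5)[OF \<pi> h[OF ab(1)] h[OF ab(2)] \<phi>])
  next
    fix c a \<phi> assume a: "a \<in> carrier B" and \<phi>: "\<phi> \<in> L2 M"
    show "AE x in M. \<pi> (h (cscale B c a)) \<phi> x = c * \<pi> (h a) \<phi> x"
      unfolding scale[OF a] by (rule L2_representationD(4)[OF \<pi> h[OF a] h[OF a] \<phi>])
  next
    fix a \<phi> \<psi> assume a: "a \<in> carrier B" and \<phi>: "\<phi> \<in> L2 M" and \<psi>: "\<psi> \<in> L2 M"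
    show "L2_inner M (\<pi> (h a) \<phi>) \<psi> = L2_inner M \<phi> (\<pi> (h (cadj B a)) \<psi>)"
      unfolding adj[OF a] by (rule L2_representationD(7)[OF \<pi> h[OF a] h[OF a] \<phi> \<psi>])
  next
    fix \<phi> assume \<phi>: "\<phi> \<in> L2 M"
    show "AE x in M. \<pi> \<one>\<^bsub>A\<^esub> \<phi> x = \<phi> x"
      using \<pi> \<phi> by (simp add: L2_representation_def L2_operator_eq_def)
  qed
qed

section \<open>Semifinite measures and uniqueness of Radon-Nikodym derivatives\<close>

definition semifinite :: "'x measure \<Rightarrow> bool" where
  "semifinite M \<longleftrightarrow> (\<forall>E\<in>sets M. 0 < emeasure M E \<longrightarrow>
     (\<exists>F\<in>sets M. F \<subseteq> E \<and> 0 < emeasure M F \<and> emeasure M F < \<infinity>))"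

text \<open>If the densities differed on a set of positive measure, semifiniteness would give a part
  \<open>F\<close> of it of finite positive measure. Restricted to \<open>F\<close> the measure is
  finite, and there densities are unique.\<close>

lemma semifinite_density_unique:
  assumes M: "semifinite M" and f[measurable]: "f \<in> borel_measurable M"
    and g[measurable]: "g \<in> borel_measurable M" and eq: "density M f = density M g"
  shows "AE x in M. f x = g x"
proof (rule ccontr)
  assume not: "\<not> (AE x in M. f x = g x)"
  let ?E = "{x\<in>space M. f x \<noteq> g x}"
  have E: "?E \<in> sets M"
    by measurable
  have "emeasure M ?E \<noteq> 0"
    using not AE_iff_measurable[OF E, of "\<lambda>x. f x = g x"] by auto
  then obtain F where F[measurable]: "F \<in> sets M" and FE: "F \<subseteq> ?E"
    and pos: "0 < emeasure M F" and fin: "emeasure M F < \<infinity>"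
    using M E by (auto simp: semifinite_def zero_less_iff_neq_zero)
  interpret N: finite_measure "density M (indicator F)"
    using fin by (intro finite_measureI) (simp add: emeasure_density)
  have "density (density M (indicator F)) f = density (density M (indicator F)) g"
    using arg_cong[OF eq, of "\<lambda>N. density N (indicator F)"]
    by (simp add: density_density_eq mult.commute)
  then have "AE x in density M (indicator F). f x = g x"
    using N.density_unique_iff[of f g] by simp
  then have "AE x in M. x \<notin> F"
    using FE by (subst (asm) AE_density) (auto elim!: eventually_mono simp: indicator_def split: if_splits)
  then show False
    using pos AE_iff_null_sets[OF F] null_setsD1[of F M] by simp
qed

text \<open>If the integral were finite, Markov's inequality would give each set where
  \<open>n * f\<close> is at least 1 a finite measure, hence measure zero. As \<open>f\<close> is
  positive, these sets exhaust \<open>E\<close> up to a null set.\<close>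

lemma nn_integral_eq_infinity:
  fixes f :: "'x \<Rightarrow> ennreal"
  assumes f[measurable]: "f \<in> borel_measurable M" and pos: "AE x in M. 0 < f x"
    and E[measurable]: "E \<in> sets M" "0 < emeasure M E"
    and purely_infinite: "\<And>F. F \<in> sets M \<Longrightarrow> F \<subseteq> E \<Longrightarrow> emeasure M F = 0 \<or> emeasure M F = \<infinity>"
  shows "(\<integral>\<^sup>+x. f x * indicator E x \<partial>M) = \<infinity>"
proof (rule ccontr)
  assume "(\<integral>\<^sup>+x. f x * indicator E x \<partial>M) \<noteq> \<infinity>"
  then have fin: "(\<integral>\<^sup>+x. f x * indicator E x \<partial>M) < \<infinity>"
    by (simp add: less_top)
  let ?F = "\<lambda>n::nat. {x\<in>E. 1 \<le> of_nat n * f x}"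
  have "?F n = {x\<in>space M. 1 \<le> of_nat n * f x} \<inter> E" for n
    using sets.sets_into_space[OF E(1)] by auto
  then have F: "?F n \<in> sets M" for n
    by simp
  have "emeasure M (?F n) = 0" for n
  proof -
    have "emeasure M (?F n) \<le> of_nat n * (\<integral>\<^sup>+x. f x * indicator E x \<partial>M)"
      by (rule nn_integral_Markov_inequality) auto
    also have "\<dots> < \<infinity>"
      using fin by (simp add: ennreal_mult_less_top of_nat_less_top)
    finally show ?thesis
      using purely_infinite[OF F[of n]] by auto
  qed
  then have "AE x in M. \<forall>n. x \<notin> ?F n"
    using F by (subst AE_all_countable, intro allI AE_not_in) (simp add: null_sets_def)
  then have "AE x in M. x \<notin> E"
    using pos
  proof eventually_elim
    case (elim x)
    show ?case
    proof
      assume x: "x \<in> E"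
      have "\<exists>n::nat. 1 \<le> of_nat n * f x"
      proof (cases "f x")
        case (real r)
        then have "0 < r"
          using elim by simp
        then obtain n :: nat where "1 < of_nat n * r"
          using ex_less_of_nat_mult by blast
        then show ?thesis
          using real by (intro exI[of _ n])
            (auto simp: ennreal_of_nat_eq_real_of_nat simp flip: ennreal_mult ennreal_1 intro!: ennreal_leI)
      qed (auto intro: exI[of _ 1])
      then show False
        using elim x sets.sets_into_space[OF E(1)] by blast
    qed
  qed
  then show False
    using E(2) AE_iff_null_sets[OF E(1)] null_setsD1[of E M] by simp
qed

text \<open>
  On a set whose measurable subsets have measure \<open>0\<close> or \<open>\<infinity>\<close>, all positive densities define the
  same measure, so uniqueness of one positive derivative excludes such sets.
\<close>

lemma semifiniteI_density_unique:
  assumes f[measurable]: "f \<in> borel_measurable M" and pos: "AE x in M. 0 < f x"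
    and unique: "\<And>g. g \<in> borel_measurable M \<Longrightarrow> density M g = density M f \<Longrightarrow> AE x in M. g x = f x"
  shows "semifinite M"
  unfolding semifinite_def
proof (intro ballI impI, rule ccontr)
  fix E assume E[measurable]: "E \<in> sets M" and E_pos: "0 < emeasure M E"
    and not: "\<not> (\<exists>F\<in>sets M. F \<subseteq> E \<and> 0 < emeasure M F \<and> emeasure M F < \<infinity>)"
  then have pinf: "emeasure M F = 0 \<or> emeasure M F = \<infinity>" if "F \<in> sets M" "F \<subseteq> E" for F
    using that by (auto simp: zero_less_iff_neq_zero less_top)
  \<comment> \<open>Overwriting \<open>f\<close> on \<open>E\<close> by a positive constant does not
    change the measure. The constants 1 and 2 are both used: each would equal \<open>f\<close>
    almost everywhere on \<open>E\<close>, which forces \<open>E\<close> to be null.\<close>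
  define g :: "ennreal \<Rightarrow> 'a \<Rightarrow> ennreal" where "g c x = (if x \<in> E then c else f x)" for c x
  have g[measurable]: "g c \<in> borel_measurable M" for c
    unfolding g_def by measurable
  have "AE x in M. g c x = f x" if c: "0 < c" for c
  proof (rule unique[OF g])
    show "density M (g c) = density M f"
    proof (rule measure_eqI)
      fix B assume "B \<in> sets (density M (g c))"
      then have B[measurable]: "B \<in> sets M"
        by simp
      have "(\<integral>\<^sup>+x. g c x * indicator B x \<partial>M) = (\<integral>\<^sup>+x. f x * indicator B x \<partial>M)"
      proof (cases "emeasure M (B \<inter> E) = 0")
        case True
        then have "AE x in M. x \<notin> B \<inter> E"
          by (intro AE_not_in) (simp add: null_sets_def)
        then show ?thesis
          by (intro nn_integral_cong_AE) (auto simp: g_def indicator_def)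
      next
        case False
        \<comment> \<open>\<open>B\<close> meets \<open>E\<close> in positive measure, so any
          positive density integrates to infinity over \<open>B\<close>.\<close>
        have *: "(\<integral>\<^sup>+x. u x * indicator B x \<partial>M) = \<infinity>"
          if [measurable]: "u \<in> borel_measurable M" and "AE x in M. 0 < u x" for u :: "'a \<Rightarrow> ennreal"
        proof -
          have "(\<integral>\<^sup>+x. u x * indicator (B \<inter> E) x \<partial>M) = \<infinity>"
            using that False by (intro nn_integral_eq_infinity pinf) (auto simp: zero_less_iff_neq_zero)
          moreover have "(\<integral>\<^sup>+x. u x * indicator (B \<inter> E) x \<partial>M) \<le> (\<integral>\<^sup>+x. u x * indicator B x \<partial>M)"
            by (intro nn_integral_mono) (auto simp: indicator_def)
          ultimately show ?thesis
            by (simp add: top_unique)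
        qed
        have "AE x in M. 0 < g c x"
          using pos c by (auto simp: g_def)
        then show ?thesis
          using *[OF g] *[OF f pos] by simp
      qed
      then show "emeasure (density M (g c)) B = emeasure (density M f) B"
        by (simp add: emeasure_density)
    qed simp
  qed
  from this[of 1] this[of 2] have "AE x in M. g 1 x = f x" "AE x in M. g 2 x = f x"
    by simp_all
  then have "AE x in M. x \<notin> E"
  proof eventually_elim
    case (elim x)
    then have "g 1 x = g 2 x"
      by simp
    then show "x \<notin> E"
      by (simp add: g_def split: if_splits)
  qed
  then show False
    using E_pos AE_iff_null_sets[OF E] null_setsD1[of E M] by simp
qed

lemma semifinite_restrict_space:
  assumes M: "semifinite M" and R: "R \<in> sets M"
  shows "semifinite (restrict_space M R)"
proof -
  have R': "R \<inter> space M \<in> sets M"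
    using R by simp
  show ?thesis
    unfolding semifinite_def
  proof (intro ballI impI)
    fix E assume "E \<in> sets (restrict_space M R)" "0 < emeasure (restrict_space M R) E"
    then have E: "E \<subseteq> R" "E \<in> sets M" "0 < emeasure M E"
      using emeasure_restrict_space[OF R', of E] by (auto simp: sets_restrict_space_iff[OF R'])
    then obtain F where F: "F \<in> sets M" "F \<subseteq> E" "0 < emeasure M F" "emeasure M F < \<infinity>"
      using M by (auto simp: semifinite_def)
    then show "\<exists>F\<in>sets (restrict_space M R). F \<subseteq> E \<and> 0 < emeasure (restrict_space M R) F \<and>
        emeasure (restrict_space M R) F < \<infinity>"
      using E emeasure_restrict_space[OF R', of F]
      by (intro bexI[of _ F]) (auto simp: sets_restrict_space_iff[OF R'])
  qed
qed

text \<open>\<open>measure_of\<close> sees a set function only through its values on the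
  sigma-algebra. Agreement there with a genuine measure \<open>N\<close> therefore identifies the
  result and also discharges the guard that it is a measure.\<close>

lemma comp_measure_eqI:
  assumes sets: "sets N = sets K" and img: "\<And>E. E \<in> sets K \<Longrightarrow> T ` E \<in> sets M"
    and eq: "\<And>E. E \<in> sets K \<Longrightarrow> emeasure N E = emeasure M (T ` E)"
  shows "comp_measure K M T = N" "comp_measure_ok K M T"
proof -
  have sp: "space N = space K"
    using sets by (rule sets_eq_imp_space_eq)
  have eq': "emeasure M (T ` E) = emeasure N E" if "E \<in> sigma_sets (space N) (sets N)" for E
    using that eq[of E] unfolding sets.sigma_sets_eq by (simp add: sets)
  have "comp_measure K M T = measure_of (space N) (sets N) (emeasure N)"
    unfolding comp_measure_def sp[symmetric] sets[symmetric]
    by (intro measure_of_eq sets.space_closed eq')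
  then show "comp_measure K M T = N"
    by (simp add: measure_of_of_measure)
  have "measure_space (space N) (sigma_sets (space N) (sets N)) (\<lambda>E. emeasure M (T ` E)) =
      measure_space (space N) (sigma_sets (space N) (sets N)) (emeasure N)"
    by (intro measure_space_eq sets.space_closed eq')
  then show "comp_measure_ok K M T"
    using img measure_space[of N] sets.sigma_sets_eq[of N]
    by (simp add: comp_measure_ok_def sets sp)
qed

lemma emeasure_comp_measure:
  assumes "comp_measure_ok K M T" "E \<in> sets K"
  shows "emeasure (comp_measure K M T) E = emeasure M (T ` E)"
  unfolding comp_measure_def using assms
  by (intro emeasure_measure_of_sigma)
    (auto simp: comp_measure_ok_def measure_space_def)

section \<open>Nonsingular injections\<close>

text \<open>The derivative is represented by a version \<open>p\<close> that is real and positive at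
  every point, so roots and reciprocals of it carry no exceptional sets.\<close>

locale nonsingular_injection =
  fixes M :: "'x measure" and h :: "'x \<Rightarrow> 'x" and p :: "'x \<Rightarrow> real"
  assumes meas[measurable]: "h \<in> measurable M M"
    and inj: "inj_on h (space M)"
    and image: "E \<in> sets M \<Longrightarrow> h ` E \<in> sets M"
    and deriv_meas[measurable]: "p \<in> borel_measurable M"
    and pos: "0 < p x"
    and emeasure_image: "E \<in> sets M \<Longrightarrow> emeasure M (h ` E) = (\<integral>\<^sup>+x. ennreal (p x) * indicator E x \<partial>M)"
begin

lemma range_meas[measurable]: "h ` space M \<in> sets M"
  by (simp add: image)

lemma image_vimage: "E \<subseteq> space M \<Longrightarrow> h ` (h -` E \<inter> space M) = E \<inter> h ` space M"
  by auto

text \<open>This is the change of variables in terms of measures; the formulas for both kinds of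
  integrals are read off from it.\<close>

lemma distr_density: "distr (density M (\<lambda>x. ennreal (p x))) M h = density M (indicator (h ` space M))"
proof (rule measure_eqI)
  fix E assume "E \<in> sets (distr (density M (\<lambda>x. ennreal (p x))) M h)"
  then have E[measurable]: "E \<in> sets M"
    by simp
  have "emeasure (distr (density M (\<lambda>x. ennreal (p x))) M h) E =
      (\<integral>\<^sup>+x. ennreal (p x) * indicator (h -` E \<inter> space M) x \<partial>M)"
    by (simp add: emeasure_distr emeasure_density)
  also have "\<dots> = emeasure M (E \<inter> h ` space M)"
    using sets.sets_into_space[OF E] by (simp add: emeasure_image[symmetric] image_vimage)
  also have "\<dots> = emeasure (density M (indicator (h ` space M))) E"
    by (simp add: emeasure_density Int_commute flip: indicator_inter_arith)
  finally show "emeasure (distr (density M (\<lambda>x. ennreal (p x))) M h) E =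
      emeasure (density M (indicator (h ` space M))) E" .
qed simp

lemma nn_integral_image:
  assumes [measurable]: "u \<in> borel_measurable M"
  shows "(\<integral>\<^sup>+x. ennreal (p x) * u (h x) \<partial>M) = (\<integral>\<^sup>+y. indicator (h ` space M) y * u y \<partial>M)"
  using arg_cong[OF distr_density, of "\<lambda>N. nn_integral N u"]
  by (simp add: nn_integral_distr nn_integral_density)

lemma nn_integral_image_set:
  assumes [measurable]: "u \<in> borel_measurable M" and E[measurable]: "E \<in> sets M"
  shows "(\<integral>\<^sup>+y. u y * indicator (h ` E) y \<partial>M) = (\<integral>\<^sup>+x. ennreal (p x) * u (h x) * indicator E x \<partial>M)"
proof -
  have [measurable]: "h ` E \<in> sets M"
    by (simp add: image)
  have sub: "E \<subseteq> space M"
    using sets.sets_into_space[OF E] .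
  have "(\<integral>\<^sup>+y. u y * indicator (h ` E) y \<partial>M) =
      (\<integral>\<^sup>+y. indicator (h ` space M) y * (u y * indicator (h ` E) y) \<partial>M)"
    using sub by (intro nn_integral_cong) (auto simp: indicator_def)
  also have "\<dots> = (\<integral>\<^sup>+x. ennreal (p x) * (u (h x) * indicator (h ` E) (h x)) \<partial>M)"
    by (rule nn_integral_image[symmetric]) measurable
  also have "\<dots> = (\<integral>\<^sup>+x. ennreal (p x) * u (h x) * indicator E x \<partial>M)"
    using inj sub by (intro nn_integral_cong) (auto simp: indicator_def inj_on_def)
  finally show ?thesis .
qed

lemma integral_image:
  fixes u :: "'x \<Rightarrow> 'b :: {banach, second_countable_topology}"
  assumes [measurable]: "u \<in> borel_measurable M"
  shows "integrable M (\<lambda>x. p x *\<^sub>R u (h x)) \<longleftrightarrow> integrable M (\<lambda>y. indicator (h ` space M) y *\<^sub>R u y)"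
    and "(LINT x|M. p x *\<^sub>R u (h x)) = (LINT y|M. indicator (h ` space M) y *\<^sub>R u y)"
proof -
  have eq: "distr (density M (\<lambda>x. ennreal (p x))) M h =
      density M (\<lambda>x. ennreal (indicator (h ` space M) x))"
    unfolding distr_density by (simp add: ennreal_indicator)
  show "integrable M (\<lambda>x. p x *\<^sub>R u (h x)) \<longleftrightarrow> integrable M (\<lambda>y. indicator (h ` space M) y *\<^sub>R u y)"
    using arg_cong[OF eq, of "\<lambda>N. integrable N u"] pos
    by (simp add: integrable_distr_eq integrable_density less_imp_le)
  show "(LINT x|M. p x *\<^sub>R u (h x)) = (LINT y|M. indicator (h ` space M) y *\<^sub>R u y)"
    using arg_cong[OF eq, of "\<lambda>N. integral\<^sup>L N u"] pos
    by (simp add: integral_distr integral_density less_imp_le)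
qed

lemma null_image:
  assumes Z: "Z \<in> null_sets M"
  shows "h ` Z \<in> null_sets M"
proof -
  have [measurable]: "Z \<in> sets M"
    using Z by auto
  have "AE x in M. ennreal (p x) * indicator Z x = 0"
    using AE_not_in[OF Z] by eventually_elim simp
  then have "emeasure M (h ` Z) = 0"
    by (simp add: emeasure_image nn_integral_0_iff_AE)
  then show ?thesis
    by (simp add: null_sets_def image)
qed

text \<open>Here positivity of \<open>p\<close> is decisive: the image of the preimage lies in
  \<open>Z\<close>, so \<open>p\<close> integrates to zero over the preimage.\<close>

lemma null_vimage:
  assumes Z: "Z \<in> null_sets M"
  shows "h -` Z \<inter> space M \<in> null_sets M"
proof -
  have [measurable]: "Z \<in> sets M"
    using Z by auto
  have V[measurable]: "h -` Z \<inter> space M \<in> sets M"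
    by measurable
  have "emeasure M (h ` (h -` Z \<inter> space M)) \<le> emeasure M Z"
    by (intro emeasure_mono) auto
  also have "\<dots> = 0"
    using Z by auto
  finally have "AE x in M. ennreal (p x) * indicator (h -` Z \<inter> space M) x = 0"
    by (simp add: emeasure_image[OF V] nn_integral_0_iff_AE)
  then have "AE x in M. x \<notin> h -` Z \<inter> space M"
  proof eventually_elim
    case (elim x)
    then show ?case
      using pos[of x] by (auto simp: indicator_def)
  qed
  then show ?thesis
    using AE_iff_null_sets[OF V] by simp
qed

lemma AE_vimage:
  assumes "AE x in M. P x"
  shows "AE x in M. P (h x)"
proof -
  obtain N where N: "N \<in> null_sets M" "{x\<in>space M. \<not> P x} \<subseteq> N"
    using assms by (auto simp: eventually_ae_filter)
  then have "{x\<in>space M. \<not> P (h x)} \<subseteq> h -` N \<inter> space M"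
    using measurable_space[OF meas] by auto
  then show ?thesis
    by (rule AE_I'[OF null_vimage[OF N(1)]])
qed

lemma AE_image:
  assumes "AE x in M. P (h x)"
  shows "AE y in M. y \<in> h ` space M \<longrightarrow> P y"
proof -
  obtain N where N: "N \<in> null_sets M" "{x\<in>space M. \<not> P (h x)} \<subseteq> N"
    using assms by (auto simp: eventually_ae_filter)
  then have "{y\<in>space M. \<not> (y \<in> h ` space M \<longrightarrow> P y)} \<subseteq> h ` N"
    by auto
  then show ?thesis
    by (rule AE_I'[OF null_image[OF N(1)]])
qed

lemma comp_measure_eq:
  "comp_measure M M h = density M (\<lambda>x. ennreal (p x))" "comp_measure_ok M M h"
  using comp_measure_eqI[of "density M (\<lambda>x. ennreal (p x))" M h M]
  by (simp_all add: image emeasure_image emeasure_density)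

lemma has_RN_deriv_image:
  assumes "semifinite M"
  shows "has_RN_deriv M (comp_measure M M h)"
  unfolding has_RN_deriv_def comp_measure_eq
  using semifinite_density_unique[OF assms] by (intro bexI[of _ "\<lambda>x. ennreal (p x)"]) auto

lemma RN_deriv_image:
  assumes "semifinite M"
  shows "AE x in M. RN_deriv M (comp_measure M M h) x = ennreal (p x)"
  unfolding comp_measure_eq
  by (rule semifinite_density_unique[OF assms]) (auto simp: density_RN_deriv_density)

text \<open>Substituting \<open>y = h x\<close> turns the integral of \<open>1 / p (F y)\<close>
  over \<open>E\<close> into that of \<open>p * (1 / p)\<close> over the preimage of
  \<open>E\<close>, and on the range of \<open>h\<close> this preimage is the image under
  \<open>F\<close>.\<close>

lemma RN_deriv_inverse:
  assumes M: "semifinite M" and F: "\<And>x. x \<in> space M \<Longrightarrow> F (h x) = x"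
  defines "K \<equiv> restrict_space M (h ` space M)"
  shows "AE x in M. x \<in> h ` space M \<longrightarrow> RN_deriv K (comp_measure K M F) x = ennreal (1 / p (F x))"
proof -
  have R: "h ` space M \<inter> space M \<in> sets M"
    by simp
  have space_K: "space K = h ` space M"
    using sets.sets_into_space[OF range_meas] by (auto simp: K_def space_restrict_space)
  have sets_K: "E \<in> sets K \<longleftrightarrow> E \<subseteq> h ` space M \<and> E \<in> sets M" for E
    unfolding K_def by (rule sets_restrict_space_iff[OF R])
  have F_image: "F ` E = h -` E \<inter> space M" if "E \<in> sets K" for E
    using that F by (force simp: sets_K)
  have F_vimage: "F -` E \<inter> h ` space M = h ` E" if "E \<in> sets M" for E
    using F sets.sets_into_space[OF that] by auto
  have F_meas[measurable]: "F \<in> measurable K M"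
    by (rule measurableI) (use F in \<open>auto simp: space_K F_vimage sets_K image dest: sets.sets_into_space\<close>)
  let ?N = "density K (\<lambda>x. ennreal (1 / p (F x)))"
  have "comp_measure K M F = ?N"
  proof (rule comp_measure_eqI(1))
    fix E assume E: "E \<in> sets K"
    then have [measurable]: "E \<in> sets M" and sub: "E \<subseteq> h ` space M"
      by (auto simp: sets_K)
    show "F ` E \<in> sets M"
      unfolding F_image[OF E] by measurable
    \<comment> \<open>\<open>F\<close> is controlled only on the range of \<open>h\<close>; the
      indicator of the range makes the integrand measurable on the whole space.\<close>
    define u :: "'x \<Rightarrow> ennreal"
      where "u y = ennreal (1 / p (F y)) * indicator E y * indicator (h ` space M) y" for y
    have u[measurable]: "u \<in> borel_measurable M"
    proof -
      have "(\<lambda>y. ennreal (1 / p (F y)) * indicator E y) \<in> borel_measurable K"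
        using E by measurable
      then show ?thesis
        unfolding u_def[abs_def] K_def by (subst (asm) borel_measurable_restrict_space_iff_ennreal[OF R])
    qed
    have "emeasure ?N E = (\<integral>\<^sup>+y. ennreal (1 / p (F y)) * indicator E y \<partial>K)"
      using E by (simp add: emeasure_density)
    also have "\<dots> = (\<integral>\<^sup>+y. indicator (h ` space M) y * u y \<partial>M)"
      unfolding K_def by (subst nn_integral_restrict_space[OF R])
        (auto intro!: nn_integral_cong simp: u_def indicator_def)
    also have "\<dots> = (\<integral>\<^sup>+x. ennreal (p x) * u (h x) \<partial>M)"
      by (simp add: nn_integral_image)
    also have "\<dots> = (\<integral>\<^sup>+x. indicator (h -` E \<inter> space M) x \<partial>M)"
      using pos F by (intro nn_integral_cong)
        (auto simp: u_def indicator_def less_imp_le less_imp_neq[THEN not_sym] simp flip: ennreal_mult)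
    also have "\<dots> = emeasure M (F ` E)"
      unfolding F_image[OF E] by (subst nn_integral_indicator) auto
    finally show "emeasure ?N E = emeasure M (F ` E)" .
  qed simp
  then have "AE x in K. RN_deriv K (comp_measure K M F) x = ennreal (1 / p (F x))"
    using semifinite_restrict_space[OF M range_meas]
    by (intro semifinite_density_unique) (auto simp: density_RN_deriv_density K_def[symmetric])
  then show ?thesis
    unfolding K_def by (simp add: AE_restrict_space_iff[OF R])
qed

end

lemma nonsingular_injection_comp:
  assumes h: "nonsingular_injection M h p" and k: "nonsingular_injection M k q"
  shows "nonsingular_injection M (\<lambda>x. h (k x)) (\<lambda>x. q x * p (k x))"
proof -
  interpret h: nonsingular_injection M h p by fact
  interpret k: nonsingular_injection M k q by fact
  have img: "(\<lambda>x. h (k x)) ` E = h ` (k ` E)" for E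
    by auto
  show ?thesis
  proof
    show "(\<lambda>x. h (k x)) \<in> measurable M M"
      by measurable
    show "inj_on (\<lambda>x. h (k x)) (space M)"
      using h.inj k.inj measurable_space[OF k.meas] by (auto simp: inj_on_def)
    show "(\<lambda>x. q x * p (k x)) \<in> borel_measurable M"
      by measurable
    show "0 < q x * p (k x)" for x
      using h.pos k.pos by simp
    fix E assume E[measurable]: "E \<in> sets M"
    show "(\<lambda>x. h (k x)) ` E \<in> sets M"
      unfolding img by (intro h.image k.image E)
    have "emeasure M (h ` (k ` E)) = (\<integral>\<^sup>+y. ennreal (p y) * indicator (k ` E) y \<partial>M)"
      by (intro h.emeasure_image k.image E)
    also have "\<dots> = (\<integral>\<^sup>+x. ennreal (q x) * ennreal (p (k x)) * indicator E x \<partial>M)"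
      by (rule k.nn_integral_image_set) auto
    finally show "emeasure M ((\<lambda>x. h (k x)) ` E) =
        (\<integral>\<^sup>+x. ennreal (q x * p (k x)) * indicator E x \<partial>M)"
      unfolding img using h.pos k.pos by (simp add: ennreal_mult less_imp_le)
  qed
qed

text \<open>The replacement \<open>k\<close> acts only on a null set, but it has to be nonsingular
  as well so that the altered values form a null set; then measures of images, and with them
  \<open>p\<close>, are unchanged. Injectivity can be lost by collisions and is therefore a
  premise.\<close>

lemma nonsingular_injection_modify:
  assumes h: "nonsingular_injection M h p" and k: "nonsingular_injection M k q"
    and N: "N \<in> null_sets M" and inj: "inj_on (\<lambda>x. if x \<in> N then k x else h x) (space M)"
  shows "nonsingular_injection M (\<lambda>x. if x \<in> N then k x else h x) p"
    (is "nonsingular_injection M ?g p")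
proof -
  interpret h: nonsingular_injection M h p by fact
  interpret k: nonsingular_injection M k q by fact
  have [measurable]: "N \<in> sets M"
    using N by auto
  have img: "?g ` E = k ` (E \<inter> N) \<union> h ` (E - N)" for E
    by auto
  show ?thesis
  proof
    show "?g \<in> measurable M M"
      by measurable
    show "inj_on ?g (space M)"
      by fact
    fix E assume E[measurable]: "E \<in> sets M"
    show "?g ` E \<in> sets M"
      unfolding img by (intro sets.Un k.image h.image) auto
    have "k ` (E \<inter> N) \<in> null_sets M"
      by (intro k.null_image) (use N in \<open>auto intro: null_set_Int1\<close>)
    then have "emeasure M (?g ` E) = emeasure M (h ` (E - N))"
      unfolding img using emeasure_Un_null_set[of "h ` (E - N)" M "k ` (E \<inter> N)"]
      by (simp add: h.image Un_commute)
    also have "\<dots> = (\<integral>\<^sup>+x. ennreal (p x) * indicator (E - N) x \<partial>M)"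
      by (intro h.emeasure_image) auto
    also have "\<dots> = (\<integral>\<^sup>+x. ennreal (p x) * indicator E x \<partial>M)"
      using AE_not_in[OF N] by (intro nn_integral_cong_AE) (auto elim!: eventually_mono simp: indicator_def)
    finally show "emeasure M (?g ` E) = (\<integral>\<^sup>+x. ennreal (p x) * indicator E x \<partial>M)" .
  qed (use h.pos in auto)
qed

lemma nonsingular_injectionI_RN_deriv:
  fixes M :: "'x measure"
  assumes h[measurable]: "h \<in> measurable M M" and inj: "inj_on h (space M)"
    and ok: "comp_measure_ok M M h" and RN: "has_RN_deriv M (comp_measure M M h)"
    and pos: "AE x in M. 0 < RN_deriv M (comp_measure M M h) x"
  shows "semifinite M" "\<exists>p. nonsingular_injection M h p"
proof -
  define N where "N = comp_measure M M h"
  define \<Phi> where "\<Phi> = RN_deriv M N"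
  have \<Phi>[measurable]: "\<Phi> \<in> borel_measurable M"
    by (simp add: \<Phi>_def)
  obtain \<Psi> where \<Psi>: "\<Psi> \<in> borel_measurable M" "density M \<Psi> = N"
    and unique: "\<And>g. g \<in> borel_measurable M \<Longrightarrow> density M g = N \<Longrightarrow> AE x in M. g x = \<Psi> x"
    using RN by (auto simp: has_RN_deriv_def N_def)
  have dens: "density M \<Phi> = N"
    unfolding \<Phi>_def by (rule RN_derivI[OF \<Psi>])
  have img: "h ` E \<in> sets M" if "E \<in> sets M" for E
    using ok that by (auto simp: comp_measure_ok_def)
  have em: "emeasure M (h ` E) = (\<integral>\<^sup>+x. \<Phi> x * indicator E x \<partial>M)" if E: "E \<in> sets M" for E
    using emeasure_comp_measure[OF ok E] E unfolding N_def[symmetric] dens[symmetric]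
    by (simp add: emeasure_density)
  show sf: "semifinite M"
  proof (rule semifiniteI_density_unique[OF \<Phi>])
    show "AE x in M. 0 < \<Phi> x"
      using pos by (simp add: \<Phi>_def N_def)
    show "AE x in M. g x = \<Phi> x" if "g \<in> borel_measurable M" "density M g = density M \<Phi>" for g
      using unique[OF that(1)] unique[OF \<Phi> dens] that(2) dens by auto
  qed
  \<comment> \<open>Where \<open>\<Phi>\<close> is infinite, images have measure 0 or infinity. If
    that set had positive measure, its image would contain a set \<open>G\<close> of finite positive
    measure, and by injectivity the preimage of \<open>G\<close> lies where \<open>\<Phi>\<close> is
    infinite, a contradiction.\<close>
  have "AE x in M. \<Phi> x < \<infinity>"
  proof (rule ccontr)
    assume not: "\<not> (AE x in M. \<Phi> x < \<infinity>)"
    let ?E = "{x\<in>space M. \<Phi> x = \<infinity>}"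
    have E[measurable]: "?E \<in> sets M"
      by measurable
    have "emeasure M ?E \<noteq> 0"
      using not AE_I'[of ?E M "\<lambda>x. \<Phi> x < \<infinity>"] E by (force simp: null_sets_def less_top)
    have inf: "(\<integral>\<^sup>+x. \<Phi> x * indicator F x \<partial>M) = \<infinity> * emeasure M F"
      if "F \<in> sets M" "F \<subseteq> ?E" for F
      using that by (subst nn_integral_cmult_indicator[symmetric])
        (auto intro!: nn_integral_cong simp: indicator_def)
    have "0 < emeasure M (h ` ?E)"
      unfolding em[OF E] inf[OF E order_refl] using \<open>emeasure M ?E \<noteq> 0\<close> by (simp add: ennreal_top_mult)
    then obtain G where G[measurable]: "G \<in> sets M" and GE: "G \<subseteq> h ` ?E"
      and G_fin: "0 < emeasure M G" "emeasure M G < \<infinity>"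
      using sf img[OF E] unfolding semifinite_def by blast
    let ?F = "h -` G \<inter> space M"
    have F[measurable]: "?F \<in> sets M"
      by measurable
    have "h ` ?F = G"
      using GE by auto
    moreover have "?F \<subseteq> ?E"
    proof
      fix x assume x: "x \<in> ?F"
      then obtain y where "y \<in> ?E" "h x = h y"
        using GE by blast
      then show "x \<in> ?E"
        using x inj by (auto dest: inj_onD)
    qed
    ultimately have "emeasure M G = \<infinity> * emeasure M ?F"
      using em[OF F] inf[OF F] by simp
    then show False
      using G_fin by (simp add: ennreal_top_mult split: if_splits)
  qed
  then have fin: "AE x in M. 0 < \<Phi> x \<and> \<Phi> x < \<infinity>"
    using pos by (simp add: \<Phi>_def N_def)
  \<comment> \<open>The value 1 on the exceptional null set makes \<open>p\<close> positive
    everywhere.\<close>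
  define p where "p x = (if 0 < enn2real (\<Phi> x) then enn2real (\<Phi> x) else 1)" for x
  have "AE x in M. ennreal (p x) = \<Phi> x"
    using fin by eventually_elim (auto simp: p_def enn2real_positive_iff)
  then have p: "(\<integral>\<^sup>+x. ennreal (p x) * indicator E x \<partial>M) = (\<integral>\<^sup>+x. \<Phi> x * indicator E x \<partial>M)" for E
    by (intro nn_integral_cong_AE) auto
  have "nonsingular_injection M h p"
  proof
    show "p \<in> borel_measurable M"
      unfolding p_def[abs_def] by measurable
  qed (auto simp: img inj em p, simp add: p_def)
  then show "\<exists>p. nonsingular_injection M h p"
    by blast
qed

section \<open>Branch operators\<close>

text \<open>The defining property of \<open>S(h) \<phi> = \<psi>\<close>, free of the choice of a coding map.\<close>

definition is_transfer ::
  "'x measure \<Rightarrow> ('x \<Rightarrow> 'x) \<Rightarrow> ('x \<Rightarrow> real) \<Rightarrow> ('x \<Rightarrow> complex) \<Rightarrow> ('x \<Rightarrow> complex) \<Rightarrow> bool" where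
  "is_transfer M h p \<phi> \<psi> \<longleftrightarrow>
     (AE x in M. \<psi> (h x) = \<phi> x / complex_of_real (sqrt (p x))) \<and>
     (AE x in M. x \<notin> h ` space M \<longrightarrow> \<psi> x = 0)"

context nonsingular_injection
begin

lemma is_transfer_unique:
  assumes "is_transfer M h p \<phi> \<psi>" "is_transfer M h p \<phi> \<psi>'"
  shows "AE x in M. \<psi> x = \<psi>' x"
proof -
  have "AE x in M. \<psi> (h x) = \<psi>' (h x)"
    using assms unfolding is_transfer_def by auto
  then have "AE x in M. x \<in> h ` space M \<longrightarrow> \<psi> x = \<psi>' x"
    by (rule AE_image)
  moreover have "AE x in M. x \<notin> h ` space M \<longrightarrow> \<psi> x = \<psi>' x"
    using assms unfolding is_transfer_def by auto
  ultimately show ?thesis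
    by eventually_elim blast
qed

lemma is_transfer_cong_AE:
  assumes "is_transfer M h p \<phi> \<psi>" "AE x in M. \<psi> x = \<psi>' x"
  shows "is_transfer M h p \<phi> \<psi>'"
  using assms AE_vimage[OF assms(2)] unfolding is_transfer_def by auto

lemma is_transfer_comp:
  assumes k: "nonsingular_injection M k q"
    and "is_transfer M h p \<psi> \<theta>" "is_transfer M k q \<phi> \<psi>"
  shows "is_transfer M (\<lambda>x. h (k x)) (\<lambda>x. q x * p (k x)) \<phi> \<theta>"
proof -
  interpret k: nonsingular_injection M k q by fact
  have \<theta>: "AE x in M. \<theta> (h x) = \<psi> x / complex_of_real (sqrt (p x))"
      "AE x in M. x \<notin> h ` space M \<longrightarrow> \<theta> x = 0"
    and \<psi>: "AE x in M. \<psi> (k x) = \<phi> x / complex_of_real (sqrt (q x))"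
      "AE x in M. x \<notin> k ` space M \<longrightarrow> \<psi> x = 0"
    using assms(2,3) by (auto simp: is_transfer_def)
  have "AE x in M. \<theta> (h (k x)) = \<phi> x / complex_of_real (sqrt (q x * p (k x)))"
    using k.AE_vimage[OF \<theta>(1)] \<psi>(1)
    by eventually_elim (simp add: real_sqrt_mult)
  \<comment> \<open>A point \<open>h x\<close> outside the range of the composition has
    \<open>x\<close> outside the range of \<open>k\<close>, where \<open>\<psi>\<close>
    vanishes.\<close>
  moreover have "AE x in M. h x \<notin> (\<lambda>x. h (k x)) ` space M \<longrightarrow> \<theta> (h x) = 0"
    using \<theta>(1) \<psi>(2) by eventually_elim auto
  then have "AE x in M. x \<in> h ` space M \<longrightarrow> x \<notin> (\<lambda>x. h (k x)) ` space M \<longrightarrow> \<theta> x = 0"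
    by (rule AE_image)
  then have "AE x in M. x \<notin> (\<lambda>x. h (k x)) ` space M \<longrightarrow> \<theta> x = 0"
    using \<theta>(2) by eventually_elim blast
  ultimately show ?thesis
    by (simp add: is_transfer_def)
qed

lemma is_transfer_modify:
  assumes N: "N \<in> null_sets M" and "is_transfer M h p \<phi> \<psi>"
  shows "is_transfer M (\<lambda>x. if x \<in> N then k x else h x) p \<phi> \<psi>"
    (is "is_transfer M ?g p \<phi> \<psi>")
proof -
  have \<psi>: "AE x in M. \<psi> (h x) = \<phi> x / complex_of_real (sqrt (p x))"
      "AE x in M. x \<notin> h ` space M \<longrightarrow> \<psi> x = 0"
    using assms(2) by (auto simp: is_transfer_def)
  have "AE x in M. \<psi> (?g x) = \<phi> x / complex_of_real (sqrt (p x))"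
    using \<psi>(1) AE_not_in[OF N] by eventually_elim simp
  \<comment> \<open>Altering \<open>h\<close> on \<open>N\<close> removes at most the image of
    \<open>N\<close> from the range, and that image is null.\<close>
  moreover have "AE x in M. x \<notin> ?g ` space M \<longrightarrow> \<psi> x = 0"
    using \<psi>(2) AE_not_in[OF null_image[OF N]]
  proof eventually_elim
    case (elim x)
    have "h ` space M \<subseteq> ?g ` space M \<union> h ` N"
      by auto
    then show ?case
      using elim by blast
  qed
  ultimately show ?thesis
    by (simp add: is_transfer_def)
qed

text \<open>At the point \<open>h x\<close> the derivative of the measure composed with
  \<open>F\<close> is \<open>1 / p x\<close>. From here on the operator is handled through this
  property alone.\<close>

lemma branch_operator_is_transfer:
  assumes M: "semifinite M" and F: "\<And>x. x \<in> space M \<Longrightarrow> F (h x) = x"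
  shows "is_transfer M h p \<phi> (branch_operator M F h \<phi>)"
proof -
  let ?K = "restrict_space M (h ` space M)"
  have "AE x in M. x \<in> h ` space M \<longrightarrow> RN_deriv ?K (comp_measure ?K M F) x = ennreal (1 / p (F x))"
    by (rule RN_deriv_inverse[OF M]) (rule F)
  from AE_vimage[OF this] AE_space
  have "AE x in M. branch_operator M F h \<phi> (h x) = \<phi> x / complex_of_real (sqrt (p x))"
  proof eventually_elim
    case (elim x)
    then show ?case
      using F pos[of x] by (simp add: branch_operator_def real_sqrt_divide less_imp_le)
  qed
  then show ?thesis
    by (simp add: is_transfer_def branch_operator_def)
qed

text \<open>\<open>L2_adjoint\<close> is an arbitrary choice among functions with the adjoint
  property. The candidate \<open>w\<close> has that property by change of variables, since
  \<open>p / sqrt p = sqrt p\<close>; hence a choice exists, and it equals \<open>w\<close> almost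
  everywhere.\<close>

lemma L2_adjoint_transfer:
  assumes T: "\<And>\<psi>. \<psi> \<in> L2 M \<Longrightarrow> T \<psi> \<in> L2 M" "\<And>\<psi>. \<psi> \<in> L2 M \<Longrightarrow> is_transfer M h p \<psi> (T \<psi>)"
    and \<theta>: "\<theta> \<in> L2 M"
  shows "L2_adjoint M T \<theta> \<in> L2 M"
    and "AE x in M. L2_adjoint M T \<theta> x = complex_of_real (sqrt (p x)) * \<theta> (h x)"
proof -
  define w where "w x = complex_of_real (sqrt (p x)) * \<theta> (h x)" for x
  note [measurable] = L2_measurable[OF \<theta>]
  have "integrable M (\<lambda>y. indicator (h ` space M) y *\<^sub>R (cmod (\<theta> y))\<^sup>2)"
    using L2_integrable[OF \<theta>] by (intro integrable_mult_indicator) auto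
  then have "integrable M (\<lambda>x. p x *\<^sub>R (cmod (\<theta> (h x)))\<^sup>2)"
    by (subst integral_image(1)) auto
  then have w: "w \<in> L2 M"
    using pos by (simp add: L2_def w_def[abs_def] norm_mult power_mult_distrib less_imp_le)
  have "L2_inner M (T \<psi>) \<theta> = L2_inner M \<psi> w" if \<psi>: "\<psi> \<in> L2 M" for \<psi>
  proof -
    note [measurable] = L2_measurable[OF T(1)[OF \<psi>]] L2_measurable[OF \<psi>] L2_measurable[OF w]
    have tr: "AE x in M. T \<psi> (h x) = \<psi> x / complex_of_real (sqrt (p x))"
        "AE x in M. x \<notin> h ` space M \<longrightarrow> T \<psi> x = 0"
      using T(2)[OF \<psi>] by (auto simp: is_transfer_def)
    have "L2_inner M (T \<psi>) \<theta> =
        (LINT y|M. indicator (h ` space M) y *\<^sub>R (T \<psi> y * cnj (\<theta> y)))"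
      unfolding L2_inner_def
    proof (rule integral_cong_AE)
      show "AE y in M. T \<psi> y * cnj (\<theta> y) = indicator (h ` space M) y *\<^sub>R (T \<psi> y * cnj (\<theta> y))"
        using tr(2) by eventually_elim (auto simp: indicator_def)
    qed measurable
    also have "\<dots> = (LINT x|M. p x *\<^sub>R (T \<psi> (h x) * cnj (\<theta> (h x))))"
      by (rule integral_image(2)[symmetric]) measurable
    also have "\<dots> = L2_inner M \<psi> w"
      unfolding L2_inner_def
    proof (rule integral_cong_AE)
      show "AE x in M. p x *\<^sub>R (T \<psi> (h x) * cnj (\<theta> (h x))) = \<psi> x * cnj (w x)"
        using tr(1)
      proof eventually_elim
        case (elim x)
        have "complex_of_real (p x) = complex_of_real (sqrt (p x)) * complex_of_real (sqrt (p x))"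
          using pos[of x] by (simp flip: of_real_mult)
        then show ?case
          using elim pos[of x] by (simp add: w_def scaleR_conv_of_real)
      qed
    qed measurable
    finally show ?thesis .
  qed
  then have "\<exists>v. v \<in> L2 M \<and> (\<forall>\<psi>\<in>L2 M. L2_inner M (T \<psi>) \<theta> = L2_inner M \<psi> v)"
    using w by blast
  from someI_ex[OF this] have adj: "L2_adjoint M T \<theta> \<in> L2 M"
    "\<And>\<psi>. \<psi> \<in> L2 M \<Longrightarrow> L2_inner M (T \<psi>) \<theta> = L2_inner M \<psi> (L2_adjoint M T \<theta>)"
    unfolding L2_adjoint_def by blast+
  show "L2_adjoint M T \<theta> \<in> L2 M"
    by fact
  show "AE x in M. L2_adjoint M T \<theta> x = complex_of_real (sqrt (p x)) * \<theta> (h x)"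
    unfolding w_def[symmetric]
    using adj(2) \<open>\<And>\<psi>. \<psi> \<in> L2 M \<Longrightarrow> L2_inner M (T \<psi>) \<theta> = L2_inner M \<psi> w\<close>
    by (intro L2_eqI_inner adj(1) w) auto
qed

end

section \<open>The branches of the jump transformation\<close>

text \<open>Recurrence is stated from time 0, where the first entry time starts to count.\<close>

locale recurrent_branches =
  f1: nonsingular_injection M f1 p1 + f2: nonsingular_injection M f2 p2
  for M :: "'x measure" and f1 f2 :: "'x \<Rightarrow> 'x" and p1 p2 :: "'x \<Rightarrow> real" +
  fixes \<sigma> :: "'x \<Rightarrow> 'x"
  assumes \<sigma>_meas[measurable]: "\<sigma> \<in> measurable M M"
    and \<sigma>_f1: "x \<in> space M \<Longrightarrow> \<sigma> (f1 x) = x"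
    and \<sigma>_f2: "x \<in> space M \<Longrightarrow> \<sigma> (f2 x) = x"
    and overlap: "f1 ` space M \<inter> f2 ` space M \<in> null_sets M"
    and cover: "AE x in M. x \<in> f1 ` space M \<union> f2 ` space M"
    and recurrent: "AE x in M. \<exists>n. (\<sigma> ^^ n) x \<in> f1 ` space M"
begin

abbreviation J :: "'x \<Rightarrow> 'x" where
  "J \<equiv> jump_transformation \<sigma> (f1 ` space M)"

text \<open>Counting starts at 0: \<open>branch n\<close> is \<open>f2^n\<close> after
  \<open>f1\<close> and belongs to the generator with index \<open>n + 1\<close>.\<close>

primrec branch :: "nat \<Rightarrow> 'x \<Rightarrow> 'x" where
  "branch 0 = f1"
| "branch (Suc n) = (\<lambda>x. f2 (branch n x))"

primrec branch_deriv :: "nat \<Rightarrow> 'x \<Rightarrow> real" where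
  "branch_deriv 0 = p1"
| "branch_deriv (Suc n) = (\<lambda>x. branch_deriv n x * p2 (branch n x))"

text \<open>
  The null set on which an orbit starting in \<open>f\<^sub>2\<^sup>n (f\<^sub>1 X)\<close> meets the overlap of the two ranges before
  time \<open>n\<close>, so that the jump is taken too early.
\<close>

definition early :: "nat \<Rightarrow> 'x set" where
  "early n = {x\<in>space M. \<exists>k\<in>{1..n}. branch k x \<in> f1 ` space M}"

definition jump_branch :: "nat \<Rightarrow> 'x \<Rightarrow> 'x" where
  "jump_branch n x = (if x \<in> early n then f1 x else branch n x)"

lemma branch_nonsingular: "nonsingular_injection M (branch n) (branch_deriv n)"
proof (induction n)
  case 0
  then show ?case
    by (simp add: f1.nonsingular_injection_axioms)
next
  case (Suc n)
  then show ?case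
    using nonsingular_injection_comp[OF f2.nonsingular_injection_axioms Suc] by simp
qed

lemma branch_meas[measurable]: "branch n \<in> measurable M M"
  using nonsingular_injection.meas[OF branch_nonsingular] .

lemma branch_space: "x \<in> space M \<Longrightarrow> branch n x \<in> space M"
  using measurable_space[OF branch_meas] .

lemma funpow_meas[measurable]: "\<sigma> ^^ n \<in> measurable M M"
  by (induction n) (auto simp: comp_def)

lemma funpow_branch: "x \<in> space M \<Longrightarrow> j \<le> n \<Longrightarrow> (\<sigma> ^^ j) (branch n x) = branch (n - j) x"
proof (induction j)
  case (Suc j)
  then obtain m where m: "n - j = Suc m" "n - Suc j = m"
    by (metis Suc_diff_Suc Suc_le_lessD)
  then show ?case
    using Suc \<sigma>_f2[OF branch_space] by simp
qed simp

text \<open>For \<open>k \<ge> 1\<close> the point \<open>branch k x\<close> lies in the range of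
  \<open>f2\<close> anyway, so meeting the range of \<open>f1\<close> means meeting the null
  overlap, whose preimage under a nonsingular map is null.\<close>

lemma early_null: "early n \<in> null_sets M"
proof -
  let ?Z = "f1 ` space M \<inter> f2 ` space M"
  have "early n = (\<Union>k\<in>{1..n}. branch k -` ?Z \<inter> space M)"
  proof -
    have "branch k x \<in> f2 ` space M" if "x \<in> space M" "k \<in> {1..n}" for k x
      using that branch_space by (cases k) auto
    moreover have "{x\<in>X. \<exists>k\<in>{1..n}. branch k x \<in> A} = (\<Union>k\<in>{1..n}. branch k -` (A \<inter> B) \<inter> X)"
      if "\<And>x k. x \<in> X \<Longrightarrow> k \<in> {1..n} \<Longrightarrow> branch k x \<in> B" for A B X
      using that by auto
    ultimately show ?thesis
      unfolding early_def by simp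
  qed
  also have "\<dots> \<in> null_sets M"
    using nonsingular_injection.null_vimage[OF branch_nonsingular overlap]
    by (intro null_sets_UN') auto
  finally show ?thesis .
qed

lemma J_f1: "x \<in> space M \<Longrightarrow> J (f1 x) = x"
proof -
  assume x: "x \<in> space M"
  then have entry: "(\<sigma> ^^ 0) (f1 x) \<in> f1 ` space M"
    by simp
  then have "first_entry_time \<sigma> (f1 ` space M) (f1 x) = 0"
    unfolding first_entry_time_def by (intro Least_equality) auto
  then have "J (f1 x) = (\<sigma> ^^ (0 + 1)) (f1 x)"
    unfolding jump_transformation_def using entry by metis
  then show ?thesis
    using \<sigma>_f1[OF x] by simp
qed

text \<open>After \<open>k < n\<close> steps the orbit is at \<open>branch (n - k) x\<close> with
  \<open>n - k\<close> between 1 and \<open>n\<close>, and outside \<open>early n\<close> such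
  points avoid the range of \<open>f1\<close>.\<close>

lemma first_entry_time_branch:
  assumes "x \<in> space M" "x \<notin> early n"
  shows "first_entry_time \<sigma> (f1 ` space M) (branch n x) = n"
  unfolding first_entry_time_def
proof (rule Least_equality)
  show "(\<sigma> ^^ n) (branch n x) \<in> f1 ` space M"
    using assms funpow_branch[of x n n] by simp
  show "n \<le> k" if "(\<sigma> ^^ k) (branch n x) \<in> f1 ` space M" for k
  proof (rule ccontr)
    assume "\<not> n \<le> k"
    then have "branch (n - k) x \<in> f1 ` space M" "n - k \<in> {1..n}"
      using that assms(1) funpow_branch[of x k n] by auto
    then show False
      using assms by (auto simp: early_def)
  qed
qed

lemma J_branch:
  assumes "x \<in> space M" "x \<notin> early n"
  shows "J (branch n x) = x"
proof -
  have n: "(\<sigma> ^^ n) (branch n x) = f1 x"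
    using assms funpow_branch[of x n n] by simp
  then have "\<exists>k. (\<sigma> ^^ k) (branch n x) \<in> f1 ` space M"
    using assms by (intro exI[of _ n]) auto
  then have "J (branch n x) = (\<sigma> ^^ (n + 1)) (branch n x)"
    unfolding jump_transformation_def first_entry_time_branch[OF assms] by simp
  then show ?thesis
    using n \<sigma>_f1[OF assms(1)] by simp
qed

lemma J_jump_branch: "x \<in> space M \<Longrightarrow> J (jump_branch n x) = x"
  by (simp add: jump_branch_def J_f1 J_branch)

lemma jump_branch_nonsingular: "nonsingular_injection M (jump_branch n) (branch_deriv n)"
proof -
  have eq: "jump_branch n = (\<lambda>x. if x \<in> early n then f1 x else branch n x)"
    by (simp add: jump_branch_def fun_eq_iff)
  have "inj_on (jump_branch n) (space M)"
    by (rule inj_on_inverseI[of _ J]) (rule J_jump_branch)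
  then show ?thesis
    unfolding eq
    by (rule nonsingular_injection_modify[OF branch_nonsingular f1.nonsingular_injection_axioms early_null])
qed

lemma jump_branch_image: "E \<in> sets M \<Longrightarrow> jump_branch n ` E \<in> sets M"
  using nonsingular_injection.image[OF jump_branch_nonsingular] .

text \<open>The jump recovers the argument of a branch, and outside the early sets the first entry
  time recovers its index. A common point of two ranges thus comes from an early set of one of
  them.\<close>

lemma jump_branch_overlap:
  assumes "n \<noteq> m"
  shows "jump_branch n ` space M \<inter> jump_branch m ` space M \<in> null_sets M"
proof (rule null_sets_subset)
  show "jump_branch n ` early n \<union> jump_branch m ` early m \<in> null_sets M"
    using nonsingular_injection.null_image[OF jump_branch_nonsingular early_null]
    by (intro null_sets.Un) auto
  show "jump_branch n ` space M \<inter> jump_branch m ` space M \<in> sets M"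
    by (intro sets.Int jump_branch_image) auto
  show "jump_branch n ` space M \<inter> jump_branch m ` space M \<subseteq>
      jump_branch n ` early n \<union> jump_branch m ` early m"
  proof
    fix z assume "z \<in> jump_branch n ` space M \<inter> jump_branch m ` space M"
    then obtain x y where x: "x \<in> space M" "z = jump_branch n x" and y: "y \<in> space M" "z = jump_branch m y"
      by blast
    then have "y = x"
      using J_jump_branch[of x n] J_jump_branch[of y m] by simp
    have "x \<in> early n \<or> x \<in> early m"
    proof (rule ccontr)
      assume "\<not> (x \<in> early n \<or> x \<in> early m)"
      then have "z = branch n x" "z = branch m x" "x \<notin> early n" "x \<notin> early m"
        using x y \<open>y = x\<close> by (auto simp: jump_branch_def)
      then show False
        using first_entry_time_branch[of x n] first_entry_time_branch[of x m] x assms by simp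
    qed
    then show "z \<in> jump_branch n ` early n \<union> jump_branch m ` early m"
      using x y \<open>y = x\<close> by blast
  qed
qed

section \<open>Almost every point lies in the range of some branch\<close>

lemma AE_\<sigma>:
  assumes "AE x in M. P x"
  shows "AE x in M. P (\<sigma> x)"
proof -
  \<comment> \<open>On each of the two ranges \<open>\<sigma>\<close> undoes a nonsingular map, so
    exceptional null sets are carried over by \<open>f1\<close> and \<open>f2\<close>, and the
    ranges cover almost everything.\<close>
  have "AE x in M. P (\<sigma> (f1 x))" "AE x in M. P (\<sigma> (f2 x))"
    using assms AE_space by (eventually_elim, simp add: \<sigma>_f1 \<sigma>_f2)+
  from f1.AE_image[OF this(1)] f2.AE_image[OF this(2)] cover show ?thesis
    by eventually_elim blast
qed

lemma AE_funpow:
  assumes "AE x in M. P x"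
  shows "AE x in M. P ((\<sigma> ^^ n) x)"
  using assms
proof (induction n arbitrary: P)
  case (Suc n)
  then show ?case
    using AE_\<sigma>[of P] Suc.IH[of "\<lambda>x. P (\<sigma> x)"] by simp
qed simp

lemma jump_branch_cover: "AE x in M. \<exists>n. x \<in> jump_branch n ` space M"
proof -
  have "AE x in M. \<forall>n. (\<sigma> ^^ n) x \<in> f1 ` space M \<union> f2 ` space M"
    using AE_funpow[OF cover] by (simp add: AE_all_countable)
  then show ?thesis
    using recurrent
  proof eventually_elim
    case (elim x)
    let ?P = "\<lambda>n. (\<sigma> ^^ n) x \<in> f1 ` space M"
    define k where "k = (LEAST n. ?P n)"
    have "?P k"
      unfolding k_def using elim(2) by (rule LeastI_ex)
    then obtain y where y: "y \<in> space M" "(\<sigma> ^^ k) x = f1 y"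
      by blast
    have not: "\<not> ?P j" if "j < k" for j
      using that not_less_Least unfolding k_def by blast
    \<comment> \<open>Read the orbit backwards from its first entry at time \<open>k\<close>. Every
      earlier point avoids the range of \<open>f1\<close>, so it lies in that of \<open>f2\<close>
      and must be the \<open>f2\<close>-image of its successor. Minimality of \<open>k\<close> also
      keeps \<open>y\<close> out of \<open>early k\<close>.\<close>
    have orbit: "(\<sigma> ^^ (k - j)) x = branch j y" if "j \<le> k" for j
      using that
    proof (induction j)
      case 0
      then show ?case
        using y by simp
    next
      case (Suc j)
      then have "(\<sigma> ^^ (k - Suc j)) x \<in> f2 ` space M"
        using elim(1) not[of "k - Suc j"] by auto
      then obtain z where z: "z \<in> space M" "(\<sigma> ^^ (k - Suc j)) x = f2 z"
        by blast
      have "k - j = Suc (k - Suc j)"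
        using Suc.prems by simp
      then have "(\<sigma> ^^ (k - j)) x = \<sigma> ((\<sigma> ^^ (k - Suc j)) x)"
        by simp
      then have "z = branch j y"
        using z \<sigma>_f2[OF z(1)] Suc by simp
      then show ?case
        using z by simp
    qed
    have "branch j y \<notin> f1 ` space M" if "j \<in> {1..k}" for j
      using that orbit[of j] not[of "k - j"] by auto
    then have "y \<notin> early k"
      unfolding early_def by blast
    then have "x = jump_branch k y"
      using orbit[of k] by (simp add: jump_branch_def)
    then show ?case
      using y by blast
  qed
qed

lemma J_space: "x \<in> space M \<Longrightarrow> J x \<in> space M"
  using measurable_space[OF funpow_meas]
  by (auto simp: jump_transformation_def simp del: funpow.simps)

section \<open>Integrals over preimages and invariance under the jump\<close>

lemma J_meas[measurable]: "J \<in> measurable M M"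
proof -
  have e: "first_entry_time \<sigma> (f1 ` space M) \<in> measurable M (count_space UNIV)"
    unfolding first_entry_time_def[abs_def] by measurable
  then have "(\<lambda>x. (\<sigma> ^^ (first_entry_time \<sigma> (f1 ` space M) x + 1)) x) \<in> measurable M M"
    by (rule measurable_compose_countable[OF funpow_meas])
  then show ?thesis
    unfolding jump_transformation_def[abs_def] by measurable
qed

text \<open>Up to null sets the preimage is the disjoint union of the images of \<open>E\<close>
  under the branches. The result is stated with the unaltered \<open>branch n\<close>, which obeys
  the recursion through \<open>f2\<close> used for telescoping.\<close>

lemma nn_integral_vimage_J:
  assumes [measurable]: "u \<in> borel_measurable M" and E[measurable]: "E \<in> sets M"
  shows "(\<integral>\<^sup>+x. u x * indicator (J -` E \<inter> space M) x \<partial>M) =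
    (\<Sum>n. \<integral>\<^sup>+x. u x * indicator (branch n ` E) x \<partial>M)"
proof -
  have sub: "E \<subseteq> space M"
    using sets.sets_into_space[OF E] .
  have [measurable]: "jump_branch n ` E \<in> sets M" for n
    by (intro jump_branch_image E)
  have disj: "AE x in M. \<forall>n m. n \<noteq> m \<longrightarrow> x \<notin> jump_branch n ` space M \<inter> jump_branch m ` space M"
    using AE_not_in[OF jump_branch_overlap] by (auto simp: AE_all_countable)
  have "(\<integral>\<^sup>+x. u x * indicator (J -` E \<inter> space M) x \<partial>M) =
      (\<integral>\<^sup>+x. (\<Sum>n. u x * indicator (jump_branch n ` E) x) \<partial>M)"
  proof (rule nn_integral_cong_AE)
    show "AE x in M. u x * indicator (J -` E \<inter> space M) x =
        (\<Sum>n. u x * indicator (jump_branch n ` E) x)"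
      using disj jump_branch_cover AE_space
    proof eventually_elim
      case (elim x)
      then obtain n y where n: "y \<in> space M" "x = jump_branch n y"
        by blast
      have "x \<in> jump_branch m ` E \<longleftrightarrow> m = n \<and> x \<in> J -` E" for m
      proof (cases "m = n")
        case True
        have "x \<in> jump_branch n ` E \<longleftrightarrow> y \<in> E"
          unfolding n(2)
          by (rule inj_on_image_mem_iff[OF nonsingular_injection.inj[OF jump_branch_nonsingular] n(1) sub])
        then show ?thesis
          using n True J_jump_branch by simp
      next
        case False
        have "x \<notin> jump_branch m ` space M"
          using elim(1) n False by blast
        then show ?thesis
          using sub False by blast
      qed
      then have "u x * indicator (jump_branch m ` E) x =
          (if m = n then u x * indicator (J -` E \<inter> space M) x else 0)" for m
        using elim(3) by (auto simp: indicator_def)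
      then show ?case
        using sums_unique[OF sums_single[of n "\<lambda>_. u x * indicator (J -` E \<inter> space M) x"]] by simp
    qed
  qed
  also have "\<dots> = (\<Sum>n. \<integral>\<^sup>+x. u x * indicator (jump_branch n ` E) x \<partial>M)"
    by (rule nn_integral_suminf) measurable
  also have "\<dots> = (\<Sum>n. \<integral>\<^sup>+x. u x * indicator (branch n ` E) x \<partial>M)"
  proof (intro suminf_cong nn_integral_cong_AE)
    fix n
    have null: "jump_branch n ` early n \<in> null_sets M" "branch n ` early n \<in> null_sets M"
      using nonsingular_injection.null_image[OF jump_branch_nonsingular early_null]
        nonsingular_injection.null_image[OF branch_nonsingular early_null] by auto
    show "AE x in M. u x * indicator (jump_branch n ` E) x = u x * indicator (branch n ` E) x"
      using AE_not_in[OF null(1)] AE_not_in[OF null(2)]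
    proof eventually_elim
      case (elim x)
      have "x \<in> jump_branch n ` E \<longleftrightarrow> x \<in> branch n ` E"
      proof
        assume "x \<in> jump_branch n ` E"
        then obtain y where "y \<in> E" "x = jump_branch n y"
          by blast
        then show "x \<in> branch n ` E"
          using elim(1) by (cases "y \<in> early n") (auto simp: jump_branch_def)
      next
        assume "x \<in> branch n ` E"
        then obtain y where "y \<in> E" "x = branch n y"
          by blast
        moreover from this have "y \<notin> early n"
          using elim(2) by blast
        ultimately have "x = jump_branch n y" "y \<in> E"
          by (simp_all add: jump_branch_def)
        then show "x \<in> jump_branch n ` E"
          by blast
      qed
      then show ?case
        by (simp add: indicator_def)
    qed
  qed
  finally show ?thesis .
qed

lemma nn_integral_vimage_\<sigma>:
  assumes [measurable]: "u \<in> borel_measurable M" and E[measurable]: "E \<in> sets M"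
  shows "(\<integral>\<^sup>+x. u x * indicator (\<sigma> -` E \<inter> space M) x \<partial>M) =
    (\<integral>\<^sup>+x. u x * indicator (f1 ` E) x \<partial>M) + (\<integral>\<^sup>+x. u x * indicator (f2 ` E) x \<partial>M)"
proof -
  have sub: "E \<subseteq> space M"
    using sets.sets_into_space[OF E] .
  have [measurable]: "f1 ` E \<in> sets M" "f2 ` E \<in> sets M"
    by (intro f1.image f2.image E)+
  have "(\<integral>\<^sup>+x. u x * indicator (\<sigma> -` E \<inter> space M) x \<partial>M) =
      (\<integral>\<^sup>+x. u x * indicator (f1 ` E) x + u x * indicator (f2 ` E) x \<partial>M)"
  proof (rule nn_integral_cong_AE)
    show "AE x in M. u x * indicator (\<sigma> -` E \<inter> space M) x =
        u x * indicator (f1 ` E) x + u x * indicator (f2 ` E) x"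
      using cover AE_not_in[OF overlap] AE_space
    proof eventually_elim
      case (elim x)
      have "x \<in> f1 ` E \<longleftrightarrow> x \<in> f1 ` space M \<and> \<sigma> x \<in> E"
        using sub \<sigma>_f1 by (auto simp: subset_iff)
      moreover have "x \<in> f2 ` E \<longleftrightarrow> x \<in> f2 ` space M \<and> \<sigma> x \<in> E"
        using sub \<sigma>_f2 by (auto simp: subset_iff)
      ultimately show ?case
        using elim by (auto simp: indicator_def)
    qed
  qed
  also have "\<dots> = (\<integral>\<^sup>+x. u x * indicator (f1 ` E) x \<partial>M) + (\<integral>\<^sup>+x. u x * indicator (f2 ` E) x \<partial>M)"
    by (rule nn_integral_add) measurable
  finally show ?thesis .
qed

lemma nn_integral_jump_invariant:
  assumes u[measurable]: "u \<in> borel_measurable M" and fin: "(\<integral>\<^sup>+x. u x \<partial>M) < \<infinity>"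
    and inv: "\<And>E. E \<in> sets M \<Longrightarrow>
      (\<integral>\<^sup>+x. u x * indicator (\<sigma> -` E \<inter> space M) x \<partial>M) = (\<integral>\<^sup>+x. u x * indicator E x \<partial>M)"
    and E[measurable]: "E \<in> sets M"
  shows "(\<integral>\<^sup>+x. ennreal (p1 x) * u (f1 x) * indicator (J -` E \<inter> space M) x \<partial>M) =
    (\<integral>\<^sup>+x. ennreal (p1 x) * u (f1 x) * indicator E x \<partial>M)"
proof -
  define \<nu> where "\<nu> F = (\<integral>\<^sup>+x. u x * indicator F x \<partial>M)" for F
  define b where "b n = branch n ` E" for n
  have b: "b n \<in> sets M" for n
    unfolding b_def by (rule nonsingular_injection.image[OF branch_nonsingular E])
  have \<nu>_f1: "(\<integral>\<^sup>+x. ennreal (p1 x) * u (f1 x) * indicator F x \<partial>M) = \<nu> (f1 ` F)" if "F \<in> sets M" for F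
    unfolding \<nu>_def by (rule f1.nn_integral_image_set[OF u that, symmetric])
  have b_Suc: "b (Suc n) = f2 ` b n" for n
    by (auto simp: b_def)
  have split: "\<nu> (b n) = \<nu> (f1 ` b n) + \<nu> (b (Suc n))" for n
    unfolding b_Suc using inv[OF b] nn_integral_vimage_\<sigma>[OF u b] by (simp add: \<nu>_def)
  \<comment> \<open>Each splitting moves one term into the sum and leaves the next
    remainder.\<close>
  have partial: "(\<Sum>k<n. \<nu> (f1 ` b k)) + \<nu> (b n) = \<nu> (b 0)" for n
    by (induction n) (simp_all add: split[symmetric] add.assoc)
  \<comment> \<open>The remainders are themselves the terms of a series bounded by the total mass;
    being summable, they tend to zero.\<close>
  have "(\<Sum>n. \<nu> (b n)) = \<nu> (J -` E \<inter> space M)"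
    unfolding \<nu>_def b_def by (rule nn_integral_vimage_J[OF u E, symmetric])
  also have "\<dots> \<le> (\<integral>\<^sup>+x. u x \<partial>M)"
    unfolding \<nu>_def by (intro nn_integral_mono) (simp add: indicator_def)
  finally have sum_fin: "(\<Sum>n. \<nu> (b n)) < \<infinity>"
    using fin by simp
  have "\<nu> (b n) < \<infinity>" for n
  proof -
    have "\<nu> (b n) \<le> (\<integral>\<^sup>+x. u x \<partial>M)"
      unfolding \<nu>_def by (intro nn_integral_mono) (simp add: indicator_def)
    then show ?thesis
      using fin by simp
  qed
  \<comment> \<open>The terms are finite, so they can be treated as a summable series of reals,
    whose terms vanish in the limit.\<close>
  then have real: "\<nu> (b n) = ennreal (enn2real (\<nu> (b n)))" for n
    by simp
  have "summable (\<lambda>n. enn2real (\<nu> (b n)))"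
    using sum_fin real by (intro summable_suminf_not_top) (auto simp: less_top)
  then have "(\<lambda>n. ennreal (enn2real (\<nu> (b n)))) \<longlonglongrightarrow> ennreal 0"
    by (intro tendsto_ennrealI summable_LIMSEQ_zero)
  then have "(\<lambda>n. (\<Sum>k<n. \<nu> (f1 ` b k)) + \<nu> (b n)) \<longlonglongrightarrow> (\<Sum>k. \<nu> (f1 ` b k)) + 0"
    by (intro tendsto_add summable_LIMSEQ) (simp_all flip: real)
  then have "(\<Sum>k. \<nu> (f1 ` b k)) = \<nu> (b 0)"
    unfolding partial by (simp add: LIMSEQ_const_iff)
  moreover have "(\<integral>\<^sup>+x. ennreal (p1 x) * u (f1 x) * indicator (J -` E \<inter> space M) x \<partial>M) =
      (\<Sum>k. \<nu> (f1 ` b k))"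
    using nn_integral_vimage_J[of "\<lambda>x. ennreal (p1 x) * u (f1 x)" E] \<nu>_f1[OF b]
    by (simp add: b_def)
  ultimately show ?thesis
    using \<nu>_f1[OF E] by (simp add: b_def)
qed

end

section \<open>The jump system\<close>

lemma branching_function_system_nonsingular:
  assumes bfs: "branching_function_system M N f" and cod: "coding_map M N f F" and i: "i \<in> \<Omega> N"
  shows "semifinite M" "\<exists>p. nonsingular_injection M (f i) p"
proof -
  have "inj_on (f i) (space M)"
    using cod i by (intro inj_on_inverseI[of _ F]) (auto simp: coding_map_def)
  then show "semifinite M" "\<exists>p. nonsingular_injection M (f i) p"
    using bfs i nonsingular_injectionI_RN_deriv[of "f i" M]
    by (auto simp: branching_function_system_def)
qed

context recurrent_branches
begin

text \<open>The shift matches the indices of the generators, which start at 1. Truncated subtraction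
  sends 0 and 1 to the same branch, but 0 does not belong to the index set.\<close>

definition jump_system :: "nat \<Rightarrow> 'x \<Rightarrow> 'x" where
  "jump_system i = jump_branch (i - 1)"

lemma coding_map_jump_system: "coding_map M \<infinity> jump_system J"
  by (auto simp: coding_map_def jump_system_def J_jump_branch J_space)

lemma branching_function_system_jump_system:
  assumes M: "semifinite M"
  shows "branching_function_system M \<infinity> jump_system"
  unfolding branching_function_system_def
proof (intro conjI ballI impI)
  fix i j assume i: "i \<in> \<Omega> \<infinity>" and j: "j \<in> \<Omega> \<infinity>" and "i \<noteq> j"
  then have "i - 1 \<noteq> j - 1"
    by (auto simp: \<Omega>_def)
  from jump_branch_overlap[OF this]
  show "emeasure M (jump_system i ` space M \<inter> jump_system j ` space M) = 0"
    by (auto simp: jump_system_def)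
next
  have [measurable]: "jump_system i ` space M \<in> sets M" for i
    by (simp add: jump_system_def jump_branch_image)
  have "AE x in M. \<not> x \<in> space M - (\<Union>i\<in>\<Omega> \<infinity>. jump_system i ` space M)"
    using jump_branch_cover
  proof eventually_elim
    case (elim x)
    then obtain n where "x \<in> jump_system (Suc n) ` space M"
      by (auto simp: jump_system_def)
    then show ?case
      by (auto simp: \<Omega>_def)
  qed
  then show "emeasure M (space M - (\<Union>i\<in>\<Omega> \<infinity>. jump_system i ` space M)) = 0"
    by (intro null_setsD1, subst (asm) AE_iff_null_sets[symmetric]) auto
next
  fix i :: nat
  interpret g: nonsingular_injection M "jump_system i" "branch_deriv (i - 1)"
    unfolding jump_system_def by (rule jump_branch_nonsingular)
  show "jump_system i \<in> measurable M M"
    by (rule g.meas)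
  show "comp_measure_ok M M (jump_system i)"
    by (rule g.comp_measure_eq)
  show "has_RN_deriv M (comp_measure M M (jump_system i))"
    by (rule g.has_RN_deriv_image[OF M])
  show "AE x in M. 0 < RN_deriv M (comp_measure M M (jump_system i)) x"
    using g.RN_deriv_image[OF M] by eventually_elim (use g.pos in auto)
qed

text \<open>With \<open>a\<close> and \<open>b\<close> the generators \<open>t 1\<close> and
  \<open>t 2\<close>, each further factor \<open>b\<close> on the left composes the branch with
  \<open>f2\<close>, and the chain rule multiplies the derivatives.\<close>

lemma is_transfer_branch:
  assumes A: "unital_cstar_algebra A" and \<pi>: "L2_representation A M \<pi>"
    and a: "a \<in> carrier A" "b \<in> carrier A"
    and trans: "\<And>\<phi>. \<phi> \<in> L2 M \<Longrightarrow> is_transfer M f1 p1 \<phi> (\<pi> a \<phi>)"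
      "\<And>\<phi>. \<phi> \<in> L2 M \<Longrightarrow> is_transfer M f2 p2 \<phi> (\<pi> b \<phi>)"
    and \<phi>: "\<phi> \<in> L2 M"
  shows "is_transfer M (branch n) (branch_deriv n) \<phi> (\<pi> (b [^]\<^bsub>A\<^esub> n \<otimes>\<^bsub>A\<^esub> a) \<phi>)"
proof (induction n)
  interpret unital_cstar_algebra A by fact
  {
    case 0
    then show ?case
      using a trans(1)[OF \<phi>] by simp
  next
    case (Suc n)
    let ?c = "b [^]\<^bsub>A\<^esub> n \<otimes>\<^bsub>A\<^esub> a"
    have c: "?c \<in> carrier A"
      using a by simp
    have "b [^]\<^bsub>A\<^esub> Suc n \<otimes>\<^bsub>A\<^esub> a = b \<otimes>\<^bsub>A\<^esub> ?c"
      unfolding nat_pow_Suc2[OF a(2)] using a by (intro m_assoc) auto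
    moreover have "is_transfer M f2 p2 (\<pi> ?c \<phi>) (\<pi> (b \<otimes>\<^bsub>A\<^esub> ?c) \<phi>)"
    proof (rule f2.is_transfer_cong_AE)
      show "is_transfer M f2 p2 (\<pi> ?c \<phi>) (\<pi> b (\<pi> ?c \<phi>))"
        by (intro trans L2_representationD(1)[OF \<pi> c c \<phi>])
      show "AE x in M. \<pi> b (\<pi> ?c \<phi>) x = \<pi> (b \<otimes>\<^bsub>A\<^esub> ?c) \<phi> x"
        using L2_representationD(5)[OF \<pi> a(2) c \<phi>] by eventually_elim simp
    qed
    ultimately show ?case
      using f2.is_transfer_comp[OF branch_nonsingular _ Suc] by simp
  }
qed

text \<open>Both sides are transfers of \<open>\<phi>\<close> along the same altered branch, and a
  transfer is unique almost everywhere.\<close>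

lemma branch_operator_jump_system:
  assumes M: "semifinite M" and A: "unital_cstar_algebra A" and \<pi>: "L2_representation A M \<pi>"
    and a: "a \<in> carrier A" "b \<in> carrier A"
    and trans: "\<And>\<phi>. \<phi> \<in> L2 M \<Longrightarrow> is_transfer M f1 p1 \<phi> (\<pi> a \<phi>)"
      "\<And>\<phi>. \<phi> \<in> L2 M \<Longrightarrow> is_transfer M f2 p2 \<phi> (\<pi> b \<phi>)"
  shows "L2_operator_eq M (\<pi> (b [^]\<^bsub>A\<^esub> (i - 1) \<otimes>\<^bsub>A\<^esub> a)) (branch_operator M J (jump_system i))"
  unfolding L2_operator_eq_def
proof
  fix \<phi> assume \<phi>: "\<phi> \<in> L2 M"
  define n where "n = i - 1"
  interpret b: nonsingular_injection M "branch n" "branch_deriv n"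
    by (rule branch_nonsingular)
  interpret g: nonsingular_injection M "jump_branch n" "branch_deriv n"
    by (rule jump_branch_nonsingular)
  have "is_transfer M (jump_branch n) (branch_deriv n) \<phi> (\<pi> (b [^]\<^bsub>A\<^esub> n \<otimes>\<^bsub>A\<^esub> a) \<phi>)"
    using b.is_transfer_modify[OF early_null is_transfer_branch[OF A \<pi> a trans \<phi>], of n f1]
    by (simp add: jump_branch_def[abs_def])
  then show "AE x in M. \<pi> (b [^]\<^bsub>A\<^esub> (i - 1) \<otimes>\<^bsub>A\<^esub> a) \<phi> x =
      branch_operator M J (jump_system i) \<phi> x"
    unfolding jump_system_def n_def[symmetric]
    by (rule g.is_transfer_unique) (rule g.branch_operator_is_transfer[OF M], rule J_jump_branch)
qed

text \<open>The adjoint formula makes \<open>\<psi>\<close> equal to \<open>p1\<close> times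
  \<open>\<phi>\<close> after \<open>f1\<close> almost everywhere. As an adjoint it is complex
  valued, so it is shown to be real almost everywhere before its real part serves as the
  density.\<close>

lemma invariant_density_jump:
  assumes inv: "invariant_density M \<sigma> \<phi>" and int: "integrable M \<phi>"
    and T: "\<And>\<psi>. \<psi> \<in> L2 M \<Longrightarrow> T \<psi> \<in> L2 M" "\<And>\<psi>. \<psi> \<in> L2 M \<Longrightarrow> is_transfer M f1 p1 \<psi> (T \<psi>)"
  defines "\<psi> \<equiv> \<lambda>x. (L2_adjoint M T (\<lambda>y. complex_of_real (sqrt (\<phi> y))) x)\<^sup>2"
  shows "AE x in M. \<psi> x \<in> \<real>" "invariant_density M J (\<lambda>x. Re (\<psi> x))"
proof -
  let ?\<theta> = "\<lambda>y. complex_of_real (sqrt (\<phi> y))"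
  have \<phi>[measurable]: "\<phi> \<in> borel_measurable M" and \<phi>_pos: "AE x in M. 0 \<le> \<phi> x"
    and \<sigma>_inv: "invariant_measure (density M (\<lambda>x. ennreal (\<phi> x))) \<sigma>"
    using inv by (auto simp: invariant_density_def)
  \<comment> \<open>This holds also where \<open>\<phi>\<close> is negative: the real
    \<open>sqrt\<close> is odd, so its square is the absolute value.\<close>
  have "(cmod (?\<theta> y))\<^sup>2 = norm (\<phi> y)" for y
    by (simp add: norm_of_real power2_eq_square flip: abs_mult)
  then have \<theta>: "?\<theta> \<in> L2 M"
    using integrable_norm[OF int] by (simp add: L2_def)
  have adj: "L2_adjoint M T ?\<theta> \<in> L2 M"
      "AE x in M. L2_adjoint M T ?\<theta> x = complex_of_real (sqrt (p1 x)) * ?\<theta> (f1 x)"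
    by (rule f1.L2_adjoint_transfer[OF _ _ \<theta>]; fact T)+
  have [measurable]: "L2_adjoint M T ?\<theta> \<in> borel_measurable M"
    using L2_measurable[OF adj(1)] .
  have \<psi>_eq: "AE x in M. \<psi> x = complex_of_real (p1 x * \<phi> (f1 x))"
    using adj(2) f1.AE_vimage[OF \<phi>_pos]
  proof eventually_elim
    case (elim x)
    have "(complex_of_real (sqrt (p1 x)) * complex_of_real (sqrt (\<phi> (f1 x))))\<^sup>2 =
        complex_of_real ((sqrt (p1 x))\<^sup>2 * (sqrt (\<phi> (f1 x)))\<^sup>2)"
      by (simp add: power_mult_distrib)
    then show ?case
      using elim f1.pos[of x] by (simp add: \<psi>_def less_imp_le)
  qed
  then show "AE x in M. \<psi> x \<in> \<real>"
    by eventually_elim simp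
  have [measurable]: "(\<lambda>x. Re (\<psi> x)) \<in> borel_measurable M"
    unfolding \<psi>_def by measurable
  have \<psi>_pos: "AE x in M. 0 \<le> Re (\<psi> x)"
    using \<psi>_eq f1.AE_vimage[OF \<phi>_pos] by eventually_elim (simp add: f1.pos less_imp_le)
  have \<psi>_ennreal: "AE x in M. ennreal (Re (\<psi> x)) = ennreal (p1 x) * ennreal (\<phi> (f1 x))"
    using \<psi>_eq f1.AE_vimage[OF \<phi>_pos] by eventually_elim (simp add: f1.pos less_imp_le ennreal_mult)
  have "(\<integral>\<^sup>+x. ennreal (\<phi> x) \<partial>M) < \<infinity>"
  proof -
    have "(\<integral>\<^sup>+x. ennreal (\<phi> x) \<partial>M) \<le> (\<integral>\<^sup>+x. ennreal (norm (\<phi> x)) \<partial>M)"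
      by (intro nn_integral_mono ennreal_leI) simp
    then show ?thesis
      using int by (simp add: integrable_iff_bounded)
  qed
  moreover have "(\<integral>\<^sup>+x. ennreal (\<phi> x) * indicator (\<sigma> -` E \<inter> space M) x \<partial>M) =
      (\<integral>\<^sup>+x. ennreal (\<phi> x) * indicator E x \<partial>M)" if [measurable]: "E \<in> sets M" for E
  proof -
    have "emeasure (density M (\<lambda>x. ennreal (\<phi> x))) (\<sigma> -` E \<inter> space M) =
        emeasure (density M (\<lambda>x. ennreal (\<phi> x))) E"
      using \<sigma>_inv that by (simp add: invariant_measure_def)
    then show ?thesis
      by (simp add: emeasure_density)
  qed
  ultimately have jump: "(\<integral>\<^sup>+x. ennreal (p1 x) * ennreal (\<phi> (f1 x)) * indicator (J -` E \<inter> space M) x \<partial>M) =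
      (\<integral>\<^sup>+x. ennreal (p1 x) * ennreal (\<phi> (f1 x)) * indicator E x \<partial>M)" if "E \<in> sets M" for E
    using that by (intro nn_integral_jump_invariant) auto
  have em: "emeasure (density M (\<lambda>x. ennreal (Re (\<psi> x)))) E =
      (\<integral>\<^sup>+x. ennreal (p1 x) * ennreal (\<phi> (f1 x)) * indicator E x \<partial>M)" if [measurable]: "E \<in> sets M" for E
  proof -
    have "emeasure (density M (\<lambda>x. ennreal (Re (\<psi> x)))) E =
        (\<integral>\<^sup>+x. ennreal (Re (\<psi> x)) * indicator E x \<partial>M)"
      by (simp add: emeasure_density)
    also have "\<dots> = (\<integral>\<^sup>+x. ennreal (p1 x) * ennreal (\<phi> (f1 x)) * indicator E x \<partial>M)"
    proof (rule nn_integral_cong_AE)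
      show "AE x in M. ennreal (Re (\<psi> x)) * indicator E x =
          ennreal (p1 x) * ennreal (\<phi> (f1 x)) * indicator E x"
        using \<psi>_ennreal by eventually_elim simp
    qed
    finally show ?thesis .
  qed
  show "invariant_density M J (\<lambda>x. Re (\<psi> x))"
    unfolding invariant_density_def invariant_measure_def
  proof (intro conjI ballI)
    show "J \<in> measurable (density M (\<lambda>x. ennreal (Re (\<psi> x)))) (density M (\<lambda>x. ennreal (Re (\<psi> x))))"
      by simp
    fix E assume "E \<in> sets (density M (\<lambda>x. ennreal (Re (\<psi> x))))"
    then have E[measurable]: "E \<in> sets M"
      by simp
    have "J -` E \<inter> space M \<in> sets M"
      by measurable
    then show "emeasure (density M (\<lambda>x. ennreal (Re (\<psi> x))))
        (J -` E \<inter> space (density M (\<lambda>x. ennreal (Re (\<psi> x))))) =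
        emeasure (density M (\<lambda>x. ennreal (Re (\<psi> x)))) E"
      using jump[OF E] by (simp add: em)
  qed (use \<psi>_pos in auto)
qed

end

section \<open>From the data of the two Cuntz algebras to both claims\<close>

lemma \<Omega>_2: "\<Omega> 2 = {1, 2}"
  by (auto simp: \<Omega>_def numeral_eq_enat)

lemma \<Omega>_infinity: "i \<in> \<Omega> \<infinity> \<longleftrightarrow> 1 \<le> i"
  by (simp add: \<Omega>_def)

lemma recurrent_branchesI:
  assumes \<sigma>[measurable]: "\<sigma> \<in> measurable M M" and bfs: "branching_function_system M 2 f"
    and cod: "coding_map M 2 f \<sigma>"
    and rec: "emeasure M (space M - (\<Union>n\<in>{1..}. (\<sigma> ^^ n) -` (f 1 ` space M) \<inter> space M)) = 0"
    and f1: "nonsingular_injection M (f 1) p1" and f2: "nonsingular_injection M (f 2) p2"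
  shows "recurrent_branches M (f 1) (f 2) p1 p2 \<sigma>"
proof -
  interpret f1: nonsingular_injection M "f 1" p1 by fact
  interpret f2: nonsingular_injection M "f 2" p2 by fact
  have [measurable]: "\<sigma> ^^ n \<in> measurable M M" for n
    by (induction n) (auto simp: comp_def)
  have "(1::nat) \<noteq> 2"
    by simp
  then have ov: "emeasure M (f 1 ` space M \<inter> f 2 ` space M) = 0"
    and cov: "emeasure M (space M - (f 1 ` space M \<union> f 2 ` space M)) = 0"
    using bfs by (auto simp: branching_function_system_def \<Omega>_2)
  show ?thesis
  proof
    show "\<sigma> (f 1 x) = x" "\<sigma> (f 2 x) = x" if "x \<in> space M" for x
      using cod that by (auto simp: coding_map_def \<Omega>_2)
    show "f 1 ` space M \<inter> f 2 ` space M \<in> null_sets M"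
      by (rule null_setsI[OF ov sets.Int[OF f1.range_meas f2.range_meas]])
    have "space M - (f 1 ` space M \<union> f 2 ` space M) \<in> null_sets M"
      by (rule null_setsI[OF cov]) measurable
    from AE_not_in[OF this] AE_space show "AE x in M. x \<in> f 1 ` space M \<union> f 2 ` space M"
      by eventually_elim auto
    have "space M - (\<Union>n\<in>{1..}. (\<sigma> ^^ n) -` (f 1 ` space M) \<inter> space M) \<in> null_sets M"
      by (rule null_setsI[OF rec]) measurable
    from AE_not_in[OF this] AE_space show "AE x in M. \<exists>n. (\<sigma> ^^ n) x \<in> f 1 ` space M"
      by eventually_elim auto
  qed fact
qed

theorem theorem1p4:
  fixes M :: "'x measure" and \<sigma> :: "'x \<Rightarrow> 'x" and f :: "nat \<Rightarrow> 'x \<Rightarrow> 'x"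
    and O2 :: "'a cstar_algebra" and t :: "nat \<Rightarrow> 'a"
    and Oinf :: "'b cstar_algebra" and s :: "nat \<Rightarrow> 'b" and \<iota> :: "'b \<Rightarrow> 'a"
    and \<pi>f :: "'a \<Rightarrow> ('x \<Rightarrow> complex) \<Rightarrow> ('x \<Rightarrow> complex)"
  assumes "\<sigma> \<in> measurable M M"
    and "branching_function_system M 2 f"
    and "coding_map M 2 f \<sigma>"
    and "emeasure M (space M - (\<Union>n\<in>{1..}. (\<sigma> ^^ n) -` (f 1 ` space M) \<inter> space M)) = 0"
    and "is_cuntz_algebra 2 O2 t"
    and "associated_representation M 2 f \<sigma> O2 t \<pi>f"
    and "is_cuntz_algebra \<infinity> Oinf s"
    and "unital_star_embedding Oinf O2 \<iota>"
    and "\<forall>n\<ge>1. \<iota> (s n) = (t 2 [^]\<^bsub>O2\<^esub> (n - 1)) \<otimes>\<^bsub>O2\<^esub> t 1"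
  shows
    "(\<exists>g. branching_function_system M \<infinity> g \<and>
          coding_map M \<infinity> g (jump_transformation \<sigma> (f 1 ` space M)) \<and>
          (\<exists>\<pi>g. associated_representation M \<infinity> g (jump_transformation \<sigma> (f 1 ` space M)) Oinf s \<pi>g) \<and>
          (\<forall>\<pi>g. associated_representation M \<infinity> g (jump_transformation \<sigma> (f 1 ` space M)) Oinf s \<pi>g \<longrightarrow>
             (\<forall>a\<in>carrier Oinf. L2_operator_eq M (\<pi>f (\<iota> a)) (\<pi>g a)))) \<and>
     (\<forall>\<phi> :: 'x \<Rightarrow> real. invariant_density M \<sigma> \<phi> \<and> integrable M \<phi> \<longrightarrow>
        (let \<psi> = (\<lambda>x. (L2_adjoint M (\<pi>f (t 1)) (\<lambda>y. complex_of_real (sqrt (\<phi> y))) x)\<^sup>2)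
         in (AE x in M. \<psi> x \<in> \<real>) \<and>
            invariant_density M (jump_transformation \<sigma> (f 1 ` space M)) (\<lambda>x. Re (\<psi> x))))"
proof -
  have \<Omega>: "1 \<in> \<Omega> 2" "2 \<in> \<Omega> 2"
    by (simp_all add: \<Omega>_2)
  have M: "semifinite M"
    using branching_function_system_nonsingular(1)[OF assms(2,3) \<Omega>(1)] .
  obtain p1 p2 where f1: "nonsingular_injection M (f 1) p1" and f2: "nonsingular_injection M (f 2) p2"
    using branching_function_system_nonsingular(2)[OF assms(2,3)] \<Omega> by blast
  interpret recurrent_branches M "f 1" "f 2" p1 p2 \<sigma>
    by (rule recurrent_branchesI[OF assms(1-4) f1 f2])
  have O2: "unital_cstar_algebra O2" and t: "t 1 \<in> carrier O2" "t 2 \<in> carrier O2"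
    using assms(5) \<Omega> by (auto simp: is_cuntz_algebra_def cuntz_relations_def)
  have Oinf: "unital_cstar_algebra Oinf" and gen: "generates_cstar Oinf (s ` \<Omega> \<infinity>)"
    using assms(7) by (auto simp: is_cuntz_algebra_def)
  have \<pi>f: "L2_representation O2 M \<pi>f"
    and \<pi>t: "\<And>i. i \<in> \<Omega> 2 \<Longrightarrow> L2_operator_eq M (\<pi>f (t i)) (branch_operator M \<sigma> (f i))"
    using assms(6) by (auto simp: associated_representation_def)
  \<comment> \<open>The operators are given only up to equality almost everywhere; the transfer
    property is stable under that and forgets the coding map.\<close>
  have trans: "is_transfer M (f 1) p1 \<phi> (\<pi>f (t 1) \<phi>)" "is_transfer M (f 2) p2 \<phi> (\<pi>f (t 2) \<phi>)"
    if \<phi>: "\<phi> \<in> L2 M" for \<phi>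
  proof -
    have "AE x in M. branch_operator M \<sigma> (f i) \<phi> x = \<pi>f (t i) \<phi> x" if i: "i \<in> \<Omega> 2" for i
      using \<pi>t[OF i] \<phi> unfolding L2_operator_eq_def by (auto elim!: eventually_mono)
    note eq = this[OF \<Omega>(1)] this[OF \<Omega>(2)]
    show "is_transfer M (f 1) p1 \<phi> (\<pi>f (t 1) \<phi>)"
      by (rule f1.is_transfer_cong_AE[OF f1.branch_operator_is_transfer[OF M] eq(1)]) (rule \<sigma>_f1)
    show "is_transfer M (f 2) p2 \<phi> (\<pi>f (t 2) \<phi>)"
      by (rule f2.is_transfer_cong_AE[OF f2.branch_operator_is_transfer[OF M] eq(2)]) (rule \<sigma>_f2)
  qed
  have \<iota>: "L2_representation Oinf M (\<lambda>a. \<pi>f (\<iota> a))"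
    by (rule L2_representation_comp[OF \<pi>f]) (use assms(8) in \<open>simp add: unital_star_embedding_def\<close>)
  have gens: "L2_operator_eq M (\<pi>f (\<iota> (s i))) (branch_operator M J (jump_system i))"
    if "i \<in> \<Omega> \<infinity>" for i
    using branch_operator_jump_system[OF M O2 \<pi>f t trans] assms(9) that by (simp add: \<Omega>_infinity)
  \<comment> \<open>The restriction itself witnesses that a representation associated with the jump
    system exists.\<close>
  have "associated_representation M \<infinity> jump_system J Oinf s (\<lambda>a. \<pi>f (\<iota> a))"
    using \<iota> gens by (simp add: associated_representation_def)
  \<comment> \<open>Any other associated representation takes the same values on the generators,
    hence on the whole algebra.\<close>
  moreover have "L2_operator_eq M (\<pi>f (\<iota> a)) (\<pi>g a)"
    if rep: "associated_representation M \<infinity> jump_system J Oinf s \<pi>g" and a: "a \<in> carrier Oinf" for \<pi>g a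
  proof (rule unital_cstar_algebra.L2_representations_eqI[OF Oinf \<iota> _ gen _ a])
    show "L2_representation Oinf M \<pi>g"
      using rep by (simp add: associated_representation_def)
    fix b assume "b \<in> s ` \<Omega> \<infinity>"
    then obtain i where i: "i \<in> \<Omega> \<infinity>" "b = s i"
      by blast
    have "L2_operator_eq M (\<pi>g b) (branch_operator M J (jump_system i))"
      using rep i by (simp add: associated_representation_def)
    then show "L2_operator_eq M (\<pi>f (\<iota> b)) (\<pi>g b)"
      using gens[OF i(1)] i(2) unfolding L2_operator_eq_def by force
  qed
  ultimately have "branching_function_system M \<infinity> jump_system \<and> coding_map M \<infinity> jump_system J \<and>
      (\<exists>\<pi>g. associated_representation M \<infinity> jump_system J Oinf s \<pi>g) \<and>
      (\<forall>\<pi>g. associated_representation M \<infinity> jump_system J Oinf s \<pi>g \<longrightarrow>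
         (\<forall>a\<in>carrier Oinf. L2_operator_eq M (\<pi>f (\<iota> a)) (\<pi>g a)))"
    using branching_function_system_jump_system[OF M] coding_map_jump_system by blast
  moreover have "(AE x in M. \<psi> x \<in> \<real>) \<and> invariant_density M J (\<lambda>x. Re (\<psi> x))"
    if "invariant_density M \<sigma> \<phi>" "integrable M \<phi>"
      and "\<psi> = (\<lambda>x. (L2_adjoint M (\<pi>f (t 1)) (\<lambda>y. complex_of_real (sqrt (\<phi> y))) x)\<^sup>2)" for \<phi> \<psi>
    unfolding that(3)
    using invariant_density_jump[OF that(1,2) L2_representationD(1)[OF \<pi>f t(1) t(1)] trans(1)] by blast
  ultimately show ?thesis
    unfolding Let_def by blast
qed

end
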